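(* Let $X$ be an infinite-dimensional complex Banach space with property $(\mathbb{A})$. Then the Banach algebra $\mathcal{F}(X)$ is amenable.
   Context: $\mathcal{F}(X)$ is the Banach algebra of approximable operators on $X$: the operator-norm closure in $\mathcal{B}(X)$ (bounded operators) of the finite rank operators. A Banach algebra $\mathcal{A}$ is amenable if for every Banach $\mathcal{A}$-bimodule $Z$, every continuous derivation $D:\mathcal{A}\to Z^*$ is inner, i.e. of the form $a\mapsto a\cdot z^*-z^*\cdot a$ for some $z^*\in Z^*$. Here $Z^*$ carries the dual module actions $\langle a\cdot z^*,z\rangle=\langle z^*,z\cdot a\rangle$, $\langle z^*\cdot a,z\rangle=\langle z^*,a\cdot z\rangle$, and a derivation is a linear map with $D(ab)=a\cdot D(b)+D(a)\cdot b$. An irreducible $(n\times n)$-matrix group is a finite subgroup of $GL_n(\mathbb{C})$ whose linear span is all of $M_n(\mathbb{C})$. For a finite biorthogonal system $\{(x_i,x_j^* ) : x_i\in X,\ x_j^*\in X^*,\ i,j=1,\dots,n\}$ (i.e. $x_j^*(x_i)=\delta_{ij}$), the associated algebra homomorphism $E:M_n(\mathbb{C})\to\mathcal{F}(X)$ is $E((a_{ij}))=\sum_{i,j}a_{ij}\,x_i\otimes x_j^*$, where $x\otimes x^*$ is the operator $z\mapsto x^*(z)x$. Property $(\mathbb{A})$ for $X$: there is a net of finite biorthogonal systems $\{(x_{i,\lambda},x_{j,\lambda}^* ) : i,j=1,\dots,n_\lambda\}$ $(\lambda\in\Lambda)$ in $X\times X^*$, with corresponding maps $E_\lambda:M_{n_\lambda}(\mathbb{C})\to\mathcal{F}(X)$,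 such that with $P_\lambda=E_\lambda(I_{n_\lambda})$: (i) $P_\lambda\to 1_X$ strongly; (ii) the adjoints $P_\lambda^a\to 1_{X^*}$ strongly; (iii) for each $\lambda$ there is an irreducible $(n_\lambda\times n_\lambda)$-matrix group $\mathcal{G}_\lambda$ such that $\sup\{\|E_\lambda(g)\| : g\in\mathcal{G}_\lambda,\ \lambda\in\Lambda\}<\infty$ (operator norm). *)

theory Defs
  imports
    "HOL-Analysis.Bounded_Linear_Function"
    "Jordan_Normal_Form.Matrix"
begin

section \<open>Complex Banach spaces and Banach algebras\<close>

class complex_vector = real_vector +
  fixes scaleC :: "complex \<Rightarrow> 'a \<Rightarrow> 'a" (infixr \<open>*\<^sub>C\<close> 75)
  assumes scaleC_add_right: "c *\<^sub>C (x + y) = c *\<^sub>C x + c *\<^sub>C y"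
    and scaleC_add_left: "(c + d) *\<^sub>C x = c *\<^sub>C x + d *\<^sub>C x"
    and scaleC_scaleC: "c *\<^sub>C d *\<^sub>C x = (c * d) *\<^sub>C x"
    and scaleC_one: "1 *\<^sub>C x = x"
    and scaleR_scaleC: "r *\<^sub>R x = complex_of_real r *\<^sub>C x"

class complex_normed_vector = complex_vector + real_normed_vector +
  assumes norm_scaleC: "norm (c *\<^sub>C x) = cmod c * norm x"

class complex_banach = complex_normed_vector + banach

text \<open>Banach algebras are not assumed to be unital.\<close>

class complex_banach_algebra = complex_banach + real_normed_algebra +
  assumes mult_scaleC_left: "(c *\<^sub>C x) * y = c *\<^sub>C (x * y)"
    and mult_scaleC_right: "x * (c *\<^sub>C y) = c *\<^sub>C (x * y)"

global_interpretation complex_vector: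
  vector_space "scaleC :: complex \<Rightarrow> 'a \<Rightarrow> 'a::complex_vector"
  by standard (simp_all add: scaleC_add_right scaleC_add_left scaleC_scaleC scaleC_one)

abbreviation clinear :: "('a::complex_vector \<Rightarrow> 'b::complex_vector) \<Rightarrow> bool"
  where "clinear \<equiv> Vector_Spaces.linear scaleC scaleC"

lemma clinearI:
  assumes "\<And>x y. f (x + y) = f x + f y" and "\<And>c x. f (c *\<^sub>C x) = c *\<^sub>C f x"
  shows "clinear f"
  using assms by unfold_locales

lemma clinearD:
  assumes "clinear f"
  shows "f (x + y) = f x + f y" and "f (c *\<^sub>C x) = c *\<^sub>C f x"
proof -
  interpret Vector_Spaces.linear scaleC scaleC f by (fact assms)
  show "f (x + y) = f x + f y" and "f (c *\<^sub>C x) = c *\<^sub>C f x"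
    by (fact add scale)+
qed

definition infinite_dimensional :: "'a::complex_vector itself \<Rightarrow> bool"
  where "infinite_dimensional _ \<longleftrightarrow>
    \<not> (\<exists>B :: 'a set. finite B \<and> complex_vector.span B = UNIV)"

lemma bounded_linear_scaleC: "bounded_linear (\<lambda>x::'a::complex_normed_vector. c *\<^sub>C x)"
proof (rule bounded_linear_intro[where K = "cmod c"])
  show "c *\<^sub>C (r *\<^sub>R x) = r *\<^sub>R (c *\<^sub>C x)" for r and x :: 'a
    by (simp add: scaleR_scaleC scaleC_scaleC mult.commute)
qed (simp_all add: scaleC_add_right norm_scaleC mult.commute)

instantiation complex :: complex_banach
begin

definition scaleC_complex :: "complex \<Rightarrow> complex \<Rightarrow> complex"
  where "scaleC_complex = (*)"

instance
  by standard
    (simp_all add: scaleC_complex_def distrib_left distrib_right norm_mult scaleR_conv_of_real)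

end


section \<open>Bounded complex-linear operators\<close>

text \<open>The operators are carved out of the real-linear ones, so that the norm is the operator
  norm of the library; additivity and boundedness are already part of the type \<open>blinfun\<close>.\<close>

typedef (overloaded) ('a, 'b) cblinfun =
  "{f :: 'a::complex_normed_vector \<Rightarrow>\<^sub>L 'b::complex_normed_vector.
      \<forall>c x. blinfun_apply f (c *\<^sub>C x) = c *\<^sub>C blinfun_apply f x}"
  morphisms blinfun_of_cblinfun Abs_cblinfun
  by (rule exI[of _ 0]) (simp add: zero_blinfun.rep_eq complex_vector.scale_zero_right)

setup_lifting type_definition_cblinfun

type_synonym 'a dual = "('a, complex) cblinfun"

lift_definition cblinfun_apply ::
    "('a::complex_normed_vector, 'b::complex_normed_vector) cblinfun \<Rightarrow> 'a \<Rightarrow> 'b"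
  is blinfun_apply .

lemma cblinfun_eqI: "(\<And>x. cblinfun_apply f x = cblinfun_apply g x) \<Longrightarrow> f = g"
  by transfer (rule blinfun_eqI)

instantiation cblinfun :: (complex_normed_vector, complex_normed_vector) complex_normed_vector
begin

lift_definition norm_cblinfun :: "('a, 'b) cblinfun \<Rightarrow> real" is norm .

lift_definition zero_cblinfun :: "('a, 'b) cblinfun" is 0
  by (simp add: zero_blinfun.rep_eq)

lift_definition plus_cblinfun ::
    "('a, 'b) cblinfun \<Rightarrow> ('a, 'b) cblinfun \<Rightarrow> ('a, 'b) cblinfun" is "(+)"
  by (simp add: plus_blinfun.rep_eq scaleC_add_right)

lift_definition minus_cblinfun ::
    "('a, 'b) cblinfun \<Rightarrow> ('a, 'b) cblinfun \<Rightarrow> ('a, 'b) cblinfun" is "(-)"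
  by (simp add: minus_blinfun.rep_eq complex_vector.scale_right_diff_distrib)

lift_definition uminus_cblinfun :: "('a, 'b) cblinfun \<Rightarrow> ('a, 'b) cblinfun" is uminus
  by (simp add: uminus_blinfun.rep_eq)

lift_definition scaleR_cblinfun :: "real \<Rightarrow> ('a, 'b) cblinfun \<Rightarrow> ('a, 'b) cblinfun"
  is scaleR
  by (simp add: scaleR_blinfun.rep_eq scaleR_scaleC scaleC_scaleC mult.commute)

lift_definition scaleC_cblinfun :: "complex \<Rightarrow> ('a, 'b) cblinfun \<Rightarrow> ('a, 'b) cblinfun"
  is "\<lambda>c f. Blinfun (\<lambda>x. c *\<^sub>C blinfun_apply f x)"
  by (simp add: bounded_linear_Blinfun_apply
      bounded_linear_compose[OF bounded_linear_scaleC blinfun.bounded_linear_right]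
      scaleC_scaleC mult.commute)

definition dist_cblinfun :: "('a, 'b) cblinfun \<Rightarrow> ('a, 'b) cblinfun \<Rightarrow> real"
  where "dist_cblinfun f g = norm (f - g)"

definition sgn_cblinfun :: "('a, 'b) cblinfun \<Rightarrow> ('a, 'b) cblinfun"
  where "sgn_cblinfun f = inverse (norm f) *\<^sub>R f"

definition uniformity_cblinfun :: "(('a, 'b) cblinfun \<times> ('a, 'b) cblinfun) filter"
  where [code del]: "uniformity_cblinfun = (INF e\<in>{0 <..}. principal {(x, y). dist x y < e})"

definition open_cblinfun :: "('a, 'b) cblinfun set \<Rightarrow> bool"
  where [code del]:
    "open_cblinfun S \<longleftrightarrow> (\<forall>x\<in>S. \<forall>\<^sub>F (x', y) in uniformity. x' = x \<longrightarrow> y \<in> S)"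

lemma apply_scaleC_raw:
  "blinfun_apply (Blinfun (\<lambda>x. c *\<^sub>C blinfun_apply f x)) x = c *\<^sub>C blinfun_apply f x"
  for f :: "'a \<Rightarrow>\<^sub>L 'b"
  by (simp add: bounded_linear_Blinfun_apply
      bounded_linear_compose[OF bounded_linear_scaleC blinfun.bounded_linear_right])

instance
proof
  fix f g h :: "('a, 'b) cblinfun" and c d :: complex and r s :: real
  show "f + g + h = f + (g + h)" "f + g = g + f" "0 + f = f" "- f + f = 0" "f - g = f + - g"
    by (transfer, simp)+
  show "r *\<^sub>R (f + g) = r *\<^sub>R f + r *\<^sub>R g" "(r + s) *\<^sub>R f = r *\<^sub>R f + s *\<^sub>R f"
    "r *\<^sub>R s *\<^sub>R f = (r * s) *\<^sub>R f" "1 *\<^sub>R f = f"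
    by (transfer, simp add: scaleR_add_right scaleR_add_left)+
  show "c *\<^sub>C (f + g) = c *\<^sub>C f + c *\<^sub>C g"
    by transfer
      (rule blinfun_eqI, unfold apply_scaleC_raw,
        simp add: apply_scaleC_raw plus_blinfun.rep_eq scaleC_add_right)
  show "(c + d) *\<^sub>C f = c *\<^sub>C f + d *\<^sub>C f"
    by transfer
      (rule blinfun_eqI, unfold apply_scaleC_raw,
        simp add: apply_scaleC_raw plus_blinfun.rep_eq scaleC_add_left)
  show "c *\<^sub>C d *\<^sub>C f = (c * d) *\<^sub>C f"
    by transfer (rule blinfun_eqI, simp add: apply_scaleC_raw scaleC_scaleC)
  show "1 *\<^sub>C f = f"
    by transfer (rule blinfun_eqI, unfold apply_scaleC_raw, rule scaleC_one)
  show "r *\<^sub>R f = complex_of_real r *\<^sub>C f"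
    by transfer (rule blinfun_eqI, simp add: apply_scaleC_raw scaleR_blinfun.rep_eq scaleR_scaleC)
  show "norm (c *\<^sub>C f) = cmod c * norm f"
  proof (cases "c = 0")
    case True
    have "c *\<^sub>C f = 0"
      unfolding True by transfer (rule blinfun_eqI, unfold apply_scaleC_raw, simp)
    moreover have "norm (0 :: ('a, 'b) cblinfun) = 0" by transfer simp
    ultimately show ?thesis using True by simp
  next
    case False
    have le: "norm (b *\<^sub>C k) \<le> cmod b * norm k" for b and k :: "('a, 'b) cblinfun"
      by transfer
        (rule norm_blinfun_bound,
          unfold apply_scaleC_raw, simp_all add: norm_scaleC mult.assoc mult_left_mono norm_blinfun)
    have "inverse c *\<^sub>C c *\<^sub>C f = f"
      using False
      by transfer (rule blinfun_eqI, unfold apply_scaleC_raw,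
          simp add: scaleC_scaleC scaleC_one blinfun_apply_inverse)
    then have "norm f \<le> inverse (cmod c) * norm (c *\<^sub>C f)"
      using le[of "inverse c" "c *\<^sub>C f"] by (simp add: norm_inverse)
    then have "cmod c * norm f \<le> norm (c *\<^sub>C f)"
      using False by (simp add: field_simps)
    with le[of c f] show ?thesis by simp
  qed
  show "dist f g = norm (f - g)" by (fact dist_cblinfun_def)
  show "sgn f = inverse (norm f) *\<^sub>R f" by (fact sgn_cblinfun_def)
  show "(norm f = 0) = (f = 0)" by transfer simp
  show "norm (f + g) \<le> norm f + norm g" by transfer (rule norm_triangle_ineq)
  show "norm (r *\<^sub>R f) = \<bar>r\<bar> * norm f" by transfer simp
qed (simp_all add: uniformity_cblinfun_def open_cblinfun_def)

end

lemma cblinfun_apply_zero [simp]: "cblinfun_apply 0 x = 0"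
  by transfer simp

lemma cblinfun_apply_add: "cblinfun_apply (f + g) x = cblinfun_apply f x + cblinfun_apply g x"
  by transfer (simp add: plus_blinfun.rep_eq)

lemma cblinfun_apply_diff: "cblinfun_apply (f - g) x = cblinfun_apply f x - cblinfun_apply g x"
  by transfer (simp add: minus_blinfun.rep_eq)

lemma cblinfun_apply_scaleC: "cblinfun_apply (c *\<^sub>C f) x = c *\<^sub>C cblinfun_apply f x"
  by transfer (simp add: apply_scaleC_raw)

lemma clinear_cblinfun_apply: "clinear (cblinfun_apply f)"
  by (rule clinearI; transfer) (simp_all add: blinfun.add_right)

lemma norm_cblinfun_apply: "norm (cblinfun_apply f x) \<le> norm f * norm x"
  by transfer (rule norm_blinfun)

lemma norm_cblinfun_onorm: "norm f = onorm (cblinfun_apply f)"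
  by transfer (simp add: norm_blinfun.rep_eq)

lemma bounded_linear_cblinfun_apply: "bounded_linear (cblinfun_apply f)"
  by transfer (rule blinfun.bounded_linear_right)

instance cblinfun :: (complex_normed_vector, complex_banach) complex_banach
proof
  fix X :: "nat \<Rightarrow> ('a, 'b) cblinfun"
  assume X: "Cauchy X"
  define Y where "Y n = blinfun_of_cblinfun (X n)" for n
  have dist: "dist f g = dist (blinfun_of_cblinfun f) (blinfun_of_cblinfun g)"
    for f g :: "('a, 'b) cblinfun"
    unfolding dist_norm by transfer simp
  have "Cauchy Y"
    using X by (simp add: Cauchy_def Y_def dist)
  then obtain L where L: "Y \<longlonglongrightarrow> L"
    using Cauchy_convergent convergent_def by blast
  have lim: "(\<lambda>n. blinfun_apply (Y n) x) \<longlonglongrightarrow> blinfun_apply L x" for x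
    by (intro blinfun.tendsto L tendsto_const)
  have hom: "blinfun_apply L (c *\<^sub>C x) = c *\<^sub>C blinfun_apply L x" for c x
  proof (rule LIMSEQ_unique[OF lim])
    have "blinfun_apply (Y n) (c *\<^sub>C x) = c *\<^sub>C blinfun_apply (Y n) x" for n
      unfolding Y_def by transfer simp
    then show "(\<lambda>n. blinfun_apply (Y n) (c *\<^sub>C x)) \<longlonglongrightarrow> c *\<^sub>C blinfun_apply L x"
      using bounded_linear.tendsto[OF bounded_linear_scaleC lim] by simp
  qed
  have "X \<longlonglongrightarrow> Abs_cblinfun L"
    using L hom by (simp add: tendsto_iff dist Y_def Abs_cblinfun_inverse)
  then show "convergent X" by (rule convergentI)
qed

text \<open>\<open>CBlinfun f\<close> is meaningful only for bounded complex-linear \<open>f\<close>.\<close>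

definition CBlinfun ::
    "('a \<Rightarrow> 'b) \<Rightarrow> ('a::complex_normed_vector, 'b::complex_normed_vector) cblinfun"
  where "CBlinfun f = Abs_cblinfun (Blinfun f)"

lemma cblinfun_apply_CBlinfun:
  assumes "bounded_linear f" and "clinear f"
  shows "cblinfun_apply (CBlinfun f) = f"
  using assms
  by (simp add: CBlinfun_def cblinfun_apply.rep_eq Abs_cblinfun_inverse
      bounded_linear_Blinfun_apply clinearD)

lift_definition cblinfun_compose ::
    "('b::complex_normed_vector, 'c::complex_normed_vector) cblinfun \<Rightarrow>
     ('a::complex_normed_vector, 'b) cblinfun \<Rightarrow> ('a, 'c) cblinfun"
  is blinfun_compose
  by simp

lemma cblinfun_apply_compose [simp]:
  "cblinfun_apply (cblinfun_compose f g) x = cblinfun_apply f (cblinfun_apply g x)"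
  by transfer simp

lemma norm_cblinfun_compose: "norm (cblinfun_compose f g) \<le> norm f * norm g"
  by transfer (rule norm_blinfun_compose)

lemma bounded_bilinear_cblinfun_compose: "bounded_bilinear (cblinfun_compose ::
    ('b::complex_normed_vector, 'c::complex_normed_vector) cblinfun \<Rightarrow>
    ('a::complex_normed_vector, 'b) cblinfun \<Rightarrow> _)"
proof
  fix f f' :: "('b, 'c) cblinfun" and g g' :: "('a, 'b) cblinfun" and r :: real
  show "cblinfun_compose (f + f') g = cblinfun_compose f g + cblinfun_compose f' g"
    "cblinfun_compose f (g + g') = cblinfun_compose f g + cblinfun_compose f g'"
    "cblinfun_compose (r *\<^sub>R f) g = r *\<^sub>R cblinfun_compose f g"
    "cblinfun_compose f (r *\<^sub>R g) = r *\<^sub>R cblinfun_compose f g"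
    by (rule cblinfun_eqI, simp add: cblinfun_apply_add scaleR_scaleC cblinfun_apply_scaleC
        clinearD[OF clinear_cblinfun_apply])+
  show "\<exists>K. \<forall>(a :: ('b, 'c) cblinfun) (b :: ('a, 'b) cblinfun).
      norm (cblinfun_compose a b) \<le> norm a * norm b * K"
    by (rule exI[of _ 1]) (simp add: norm_cblinfun_compose)
qed

definition adjoint ::
    "('a::complex_normed_vector, 'b::complex_normed_vector) cblinfun \<Rightarrow> 'b dual \<Rightarrow> 'a dual"
  where "adjoint T \<phi> = cblinfun_compose \<phi> T"

lemma bounded_linear_rank_one:
  fixes x :: "'b::complex_normed_vector" and \<phi> :: "'a::complex_normed_vector \<Rightarrow>\<^sub>L complex"
  shows "bounded_linear (\<lambda>z. blinfun_apply \<phi> z *\<^sub>C x)"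
proof (rule bounded_linear_intro[where K = "norm \<phi> * norm x"])
  show "norm (blinfun_apply \<phi> z *\<^sub>C x) \<le> norm z * (norm \<phi> * norm x)" for z
    using mult_right_mono[OF norm_blinfun[of \<phi> z] norm_ge_zero[of x]]
    by (simp add: norm_scaleC mult_ac)
  show "blinfun_apply \<phi> (r *\<^sub>R z) *\<^sub>C x = r *\<^sub>R blinfun_apply \<phi> z *\<^sub>C x" for r z
    unfolding blinfun.scaleR_right by (simp add: scaleR_scaleC[of r x] scaleR_scaleC[of r "_ *\<^sub>C x"]
        scaleC_scaleC scaleR_conv_of_real)
qed (simp add: blinfun.add_right scaleC_add_left)

lift_definition rank_one ::
    "'b::complex_normed_vector \<Rightarrow> 'a::complex_normed_vector dual \<Rightarrow> ('a, 'b) cblinfun"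
  is "\<lambda>x \<phi>. Blinfun (\<lambda>z. blinfun_apply \<phi> z *\<^sub>C x)"
  by (simp add: bounded_linear_Blinfun_apply bounded_linear_rank_one scaleC_complex_def
      scaleC_scaleC)

lemma cblinfun_apply_rank_one:
  "cblinfun_apply (rank_one x \<phi>) z = cblinfun_apply \<phi> z *\<^sub>C x"
  by transfer (simp add: bounded_linear_Blinfun_apply bounded_linear_rank_one)


section \<open>The Banach algebra of approximable operators\<close>

definition finite_rank ::
    "('a::complex_normed_vector, 'b::complex_normed_vector) cblinfun \<Rightarrow> bool"
  where "finite_rank T \<longleftrightarrow>
    (\<exists>B. finite B \<and> range (cblinfun_apply T) \<subseteq> complex_vector.span B)"

lemma finite_rank_zero: "finite_rank 0"
  unfolding finite_rank_def
  by (rule exI[of _ "{}"]) auto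

lemma finite_rank_add:
  assumes "finite_rank S" and "finite_rank T"
  shows "finite_rank (S + T)"
proof -
  obtain A B where "finite A" "range (cblinfun_apply S) \<subseteq> complex_vector.span A"
    "finite B" "range (cblinfun_apply T) \<subseteq> complex_vector.span B"
    using assms unfolding finite_rank_def by blast
  moreover from this have "cblinfun_apply S x + cblinfun_apply T x \<in> complex_vector.span (A \<union> B)" for x
    using complex_vector.span_mono[of A "A \<union> B"] complex_vector.span_mono[of B "A \<union> B"]
    by (intro complex_vector.span_add) auto
  ultimately show ?thesis
    unfolding finite_rank_def
    by (intro exI[of _ "A \<union> B"]) (auto simp: cblinfun_apply_add)
qed

lemma finite_rank_scaleC: "finite_rank T \<Longrightarrow> finite_rank (c *\<^sub>C T)"
  unfolding finite_rank_def
  by (auto simp: cblinfun_apply_scaleC intro!: complex_vector.span_scale)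

lemma finite_rank_compose: "finite_rank S \<Longrightarrow> finite_rank (cblinfun_compose S T)"
  unfolding finite_rank_def by auto

lemma finite_rank_rank_one: "finite_rank (rank_one x \<phi>)"
  unfolding finite_rank_def
  by (rule exI[of _ "{x}"])
    (auto simp: cblinfun_apply_rank_one intro: complex_vector.span_scale complex_vector.span_base)

typedef (overloaded) 'a approximable =
  "closure {T :: ('a::complex_banach, 'a) cblinfun. finite_rank T}"
  morphisms operator_of Abs_approximable
  using finite_rank_zero closure_subset by blast

setup_lifting type_definition_approximable

lemma approximable_zero: "0 \<in> closure {T. finite_rank T}"
  using finite_rank_zero closure_subset by blast

lemma approximable_add:
  assumes "S \<in> closure {T. finite_rank T}" and "T \<in> closure {T. finite_rank T}"
  shows "S + T \<in> closure {T. finite_rank T}"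
proof -
  obtain f g where "\<forall>n. f n \<in> {T. finite_rank T}" "f \<longlonglongrightarrow> S"
    "\<forall>n. g n \<in> {T. finite_rank T}" "g \<longlonglongrightarrow> T"
    using assms unfolding closure_sequential by blast
  then have "\<forall>n. f n + g n \<in> {T. finite_rank T}" "(\<lambda>n. f n + g n) \<longlonglongrightarrow> S + T"
    by (simp_all add: finite_rank_add tendsto_add)
  then show ?thesis unfolding closure_sequential by (intro exI conjI)
qed

lemma approximable_scaleC:
  assumes "T \<in> closure {T. finite_rank T}"
  shows "c *\<^sub>C T \<in> closure {T. finite_rank T}"
proof -
  obtain f where "\<forall>n. f n \<in> {T. finite_rank T}" "f \<longlonglongrightarrow> T"
    using assms unfolding closure_sequential by blast
  then have "\<forall>n. c *\<^sub>C f n \<in> {T. finite_rank T}" "(\<lambda>n. c *\<^sub>C f n) \<longlonglongrightarrow> c *\<^sub>C T"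
    by (simp_all add: finite_rank_scaleC bounded_linear.tendsto[OF bounded_linear_scaleC])
  then show ?thesis unfolding closure_sequential by (intro exI conjI)
qed

lemma approximable_scaleR:
  "T \<in> closure {T. finite_rank T} \<Longrightarrow> r *\<^sub>R T \<in> closure {T. finite_rank T}"
  by (simp add: scaleR_scaleC approximable_scaleC)

lemma approximable_uminus:
  "T \<in> closure {T. finite_rank T} \<Longrightarrow> - T \<in> closure {T. finite_rank T}"
  using approximable_scaleR[of T "-1"] by simp

lemma approximable_diff:
  "S \<in> closure {T. finite_rank T} \<Longrightarrow> T \<in> closure {T. finite_rank T} \<Longrightarrow>
    S - T \<in> closure {T. finite_rank T}"
  using approximable_add[OF _ approximable_uminus, of S T] by simp

lemma approximable_compose:
  assumes "S \<in> closure {T. finite_rank T}" and "T \<in> closure {T. finite_rank T}"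
  shows "cblinfun_compose S T \<in> closure {T. finite_rank T}"
proof -
  obtain f g where "\<forall>n. f n \<in> {T. finite_rank T}" "f \<longlonglongrightarrow> S"
    "\<forall>n. g n \<in> {T. finite_rank T}" "g \<longlonglongrightarrow> T"
    using assms unfolding closure_sequential by blast
  then have "\<forall>n. cblinfun_compose (f n) (g n) \<in> {T. finite_rank T}"
    "(\<lambda>n. cblinfun_compose (f n) (g n)) \<longlonglongrightarrow> cblinfun_compose S T"
    by (simp_all add: finite_rank_compose
        bounded_bilinear.tendsto[OF bounded_bilinear_cblinfun_compose])
  then show ?thesis unfolding closure_sequential by (intro exI conjI)
qed

instantiation approximable :: (complex_banach) complex_normed_vector
begin

lift_definition norm_approximable :: "'a approximable \<Rightarrow> real" is norm .
lift_definition zero_approximable :: "'a approximable" is 0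
  by (rule approximable_zero)
lift_definition plus_approximable :: "'a approximable \<Rightarrow> 'a approximable \<Rightarrow> 'a approximable"
  is "(+)" by (rule approximable_add)
lift_definition minus_approximable :: "'a approximable \<Rightarrow> 'a approximable \<Rightarrow> 'a approximable"
  is "(-)" by (rule approximable_diff)
lift_definition uminus_approximable :: "'a approximable \<Rightarrow> 'a approximable"
  is uminus by (rule approximable_uminus)
lift_definition scaleR_approximable :: "real \<Rightarrow> 'a approximable \<Rightarrow> 'a approximable"
  is scaleR by (rule approximable_scaleR)
lift_definition scaleC_approximable :: "complex \<Rightarrow> 'a approximable \<Rightarrow> 'a approximable"
  is scaleC by (rule approximable_scaleC)

definition dist_approximable :: "'a approximable \<Rightarrow> 'a approximable \<Rightarrow> real"
  where "dist_approximable f g = norm (f - g)"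

definition sgn_approximable :: "'a approximable \<Rightarrow> 'a approximable"
  where "sgn_approximable f = inverse (norm f) *\<^sub>R f"

definition uniformity_approximable :: "('a approximable \<times> 'a approximable) filter"
  where [code del]: "uniformity_approximable = (INF e\<in>{0 <..}. principal {(x, y). dist x y < e})"

definition open_approximable :: "'a approximable set \<Rightarrow> bool"
  where [code del]:
    "open_approximable S \<longleftrightarrow> (\<forall>x\<in>S. \<forall>\<^sub>F (x', y) in uniformity. x' = x \<longrightarrow> y \<in> S)"

instance
proof
  fix f g h :: "'a approximable" and c d :: complex and r s :: real
  show "f + g + h = f + (g + h)" "f + g = g + f" "0 + f = f" "- f + f = 0" "f - g = f + - g"
    by (transfer, simp)+
  show "r *\<^sub>R (f + g) = r *\<^sub>R f + r *\<^sub>R g" "(r + s) *\<^sub>R f = r *\<^sub>R f + s *\<^sub>R f"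
    "r *\<^sub>R s *\<^sub>R f = (r * s) *\<^sub>R f" "1 *\<^sub>R f = f"
    by (transfer, simp add: scaleR_add_right scaleR_add_left)+
  show "c *\<^sub>C (f + g) = c *\<^sub>C f + c *\<^sub>C g" by transfer (rule scaleC_add_right)
  show "(c + d) *\<^sub>C f = c *\<^sub>C f + d *\<^sub>C f" by transfer (rule scaleC_add_left)
  show "c *\<^sub>C d *\<^sub>C f = (c * d) *\<^sub>C f" by transfer (rule scaleC_scaleC)
  show "1 *\<^sub>C f = f" by transfer (rule scaleC_one)
  show "r *\<^sub>R f = complex_of_real r *\<^sub>C f" by transfer (rule scaleR_scaleC)
  show "norm (c *\<^sub>C f) = cmod c * norm f" by transfer (rule norm_scaleC)
  show "dist f g = norm (f - g)" by (fact dist_approximable_def)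
  show "sgn f = inverse (norm f) *\<^sub>R f" by (fact sgn_approximable_def)
  show "(norm f = 0) = (f = 0)" by transfer simp
  show "norm (f + g) \<le> norm f + norm g" by transfer (rule norm_triangle_ineq)
  show "norm (r *\<^sub>R f) = \<bar>r\<bar> * norm f" by transfer simp
qed (simp_all add: uniformity_approximable_def open_approximable_def)

end

instance approximable :: (complex_banach) complex_banach
proof
  fix X :: "nat \<Rightarrow> 'a approximable"
  assume X: "Cauchy X"
  have dist: "dist f g = dist (operator_of f) (operator_of g)" for f g :: "'a approximable"
    unfolding dist_norm by transfer simp
  have "Cauchy (\<lambda>n. operator_of (X n))"
    using X by (simp add: Cauchy_def dist)
  then obtain L where L: "(\<lambda>n. operator_of (X n)) \<longlonglongrightarrow> L"
    using Cauchy_convergent convergent_def by blast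
  have "L \<in> closure {T. finite_rank T}"
    using closed_sequentially[OF closed_closure _ L] operator_of by blast
  then have "X \<longlonglongrightarrow> Abs_approximable L"
    using L by (simp add: tendsto_iff dist Abs_approximable_inverse)
  then show "convergent X" by (rule convergentI)
qed

instantiation approximable :: (complex_banach) complex_banach_algebra
begin

lift_definition times_approximable :: "'a approximable \<Rightarrow> 'a approximable \<Rightarrow> 'a approximable"
  is cblinfun_compose by (rule approximable_compose)

instance
proof
  interpret comp: bounded_bilinear
    "cblinfun_compose :: ('a, 'a) cblinfun \<Rightarrow> ('a, 'a) cblinfun \<Rightarrow> ('a, 'a) cblinfun"
    by (rule bounded_bilinear_cblinfun_compose)
  fix f g h :: "'a approximable" and c :: complex and r :: real
  show "f * g * h = f * (g * h)" by transfer (rule cblinfun_eqI, simp)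
  show "(f + g) * h = f * h + g * h" by transfer (rule comp.add_left)
  show "f * (g + h) = f * g + f * h" by transfer (rule comp.add_right)
  show "r *\<^sub>R f * g = r *\<^sub>R (f * g)" by transfer (rule comp.scaleR_left)
  show "f * r *\<^sub>R g = r *\<^sub>R (f * g)" by transfer (rule comp.scaleR_right)
  show "norm (f * g) \<le> norm f * norm g"
    by transfer (rule norm_cblinfun_compose)
  show "c *\<^sub>C f * g = c *\<^sub>C (f * g)"
    by transfer (rule cblinfun_eqI, simp add: cblinfun_apply_scaleC)
  show "f * c *\<^sub>C g = c *\<^sub>C (f * g)"
    by transfer
      (rule cblinfun_eqI, simp add: cblinfun_apply_scaleC clinearD[OF clinear_cblinfun_apply])
qed

end

lift_definition tensor ::
    "'a::complex_banach \<Rightarrow> 'a dual \<Rightarrow> 'a approximable" (infix \<open>\<otimes>\<^sub>F\<close> 76)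
  is rank_one
  using finite_rank_rank_one closure_subset by blast


section \<open>Amenability\<close>

locale banach_bimodule =
  fixes lact :: "'a::complex_banach_algebra \<Rightarrow> 'z::complex_banach \<Rightarrow> 'z"
    and ract :: "'z \<Rightarrow> 'a \<Rightarrow> 'z"
  assumes bounded_bilinear_lact: "bounded_bilinear lact"
    and bounded_bilinear_ract: "bounded_bilinear ract"
    and lact_scaleC_left: "lact (c *\<^sub>C a) z = c *\<^sub>C lact a z"
    and lact_scaleC_right: "lact a (c *\<^sub>C z) = c *\<^sub>C lact a z"
    and ract_scaleC_left: "ract (c *\<^sub>C z) a = c *\<^sub>C ract z a"
    and ract_scaleC_right: "ract z (c *\<^sub>C a) = c *\<^sub>C ract z a"
    and lact_mult: "lact (a * b) z = lact a (lact b z)"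
    and ract_mult: "ract z (a * b) = ract (ract z a) b"
    and lact_ract: "ract (lact a z) b = lact a (ract z b)"

text \<open>The left action on the dual is induced by the right action on the bimodule, and vice
  versa.\<close>

definition dual_lact ::
    "('z::complex_banach \<Rightarrow> 'a \<Rightarrow> 'z) \<Rightarrow> 'a::complex_banach_algebra \<Rightarrow> 'z dual \<Rightarrow> 'z dual"
  where "dual_lact ract a \<phi> = CBlinfun (\<lambda>z. cblinfun_apply \<phi> (ract z a))"

definition dual_ract ::
    "('a \<Rightarrow> 'z \<Rightarrow> 'z) \<Rightarrow> 'z::complex_banach dual \<Rightarrow> 'a::complex_banach_algebra \<Rightarrow> 'z dual"
  where "dual_ract lact \<phi> a = CBlinfun (\<lambda>z. cblinfun_apply \<phi> (lact a z))"

context banach_bimodule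
begin

lemma dual_lact_apply: "cblinfun_apply (dual_lact ract a \<phi>) z = cblinfun_apply \<phi> (ract z a)"
  unfolding dual_lact_def
  by (subst cblinfun_apply_CBlinfun)
    (auto intro!: clinearI bounded_linear_compose[OF bounded_linear_cblinfun_apply]
      bounded_bilinear.bounded_linear_left[OF bounded_bilinear_ract]
      simp: ract_scaleC_left bounded_bilinear.add_left[OF bounded_bilinear_ract]
      clinearD[OF clinear_cblinfun_apply])

lemma dual_ract_apply: "cblinfun_apply (dual_ract lact \<phi> a) z = cblinfun_apply \<phi> (lact a z)"
  unfolding dual_ract_def
  by (subst cblinfun_apply_CBlinfun)
    (auto intro!: clinearI bounded_linear_compose[OF bounded_linear_cblinfun_apply]
      bounded_bilinear.bounded_linear_right[OF bounded_bilinear_lact]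
      simp: lact_scaleC_right bounded_bilinear.add_right[OF bounded_bilinear_lact]
      clinearD[OF clinear_cblinfun_apply])

end

definition dual_derivation ::
    "('a::complex_banach_algebra \<Rightarrow> 'z::complex_banach \<Rightarrow> 'z) \<Rightarrow> ('z \<Rightarrow> 'a \<Rightarrow> 'z) \<Rightarrow>
     ('a \<Rightarrow> 'z dual) \<Rightarrow> bool"
  where "dual_derivation lact ract D \<longleftrightarrow>
    clinear D \<and> (\<forall>a b. D (a * b) = dual_lact ract a (D b) + dual_ract lact (D a) b)"

definition inner_dual_derivation ::
    "('a::complex_banach_algebra \<Rightarrow> 'z::complex_banach \<Rightarrow> 'z) \<Rightarrow> ('z \<Rightarrow> 'a \<Rightarrow> 'z) \<Rightarrow>
     ('a \<Rightarrow> 'z dual) \<Rightarrow> bool"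
  where "inner_dual_derivation lact ract D \<longleftrightarrow>
    (\<exists>\<phi>. \<forall>a. D a = dual_lact ract a \<phi> - dual_ract lact \<phi> a)"

text \<open>HOL cannot quantify over types inside a definition, so the type \<open>'z\<close> carrying the
  bimodules is a parameter. Amenability of \<open>'a\<close> is the conclusion
  \<open>amenable TYPE('a) TYPE('z)\<close> with \<open>'z\<close> a free, hence universally quantified, type variable.
  For this reason the predicate must not be used as a hypothesis at a single \<open>'z\<close>.\<close>

definition amenable :: "'a::complex_banach_algebra itself \<Rightarrow> 'z::complex_banach itself \<Rightarrow> bool"
  where "amenable _ _ \<longleftrightarrow>
    (\<forall>(lact :: 'a \<Rightarrow> 'z \<Rightarrow> 'z) (ract :: 'z \<Rightarrow> 'a \<Rightarrow> 'z) (D :: 'a \<Rightarrow> 'z dual).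
      banach_bimodule lact ract \<longrightarrow> dual_derivation lact ract D \<longrightarrow> continuous_on UNIV D \<longrightarrow>
      inner_dual_derivation lact ract D)"


section \<open>Property (A)\<close>

definition GL :: "nat \<Rightarrow> complex mat monoid"
  where "GL n = units_of (ring_mat TYPE(complex) n ())"

definition irreducible_matrix_group :: "nat \<Rightarrow> complex mat set \<Rightarrow> bool"
  where "irreducible_matrix_group n G \<longleftrightarrow>
    subgroup G (GL n) \<and> finite G \<and>
    (\<forall>A \<in> carrier_mat n n. \<exists>c :: complex mat \<Rightarrow> complex.
      A = mat n n (\<lambda>(i, j). \<Sum>g\<in>G. c g * g $$ (i, j)))"

text \<open>Indices run from \<open>0\<close> to \<open>n - 1\<close>, as for the matrices of the library.\<close>

definition biorthogonal ::
    "nat \<Rightarrow> (nat \<Rightarrow> 'a::complex_banach) \<Rightarrow> (nat \<Rightarrow> 'a dual) \<Rightarrow> bool"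
  where "biorthogonal n x xs \<longleftrightarrow>
    (\<forall>i<n. \<forall>j<n. cblinfun_apply (xs j) (x i) = (if i = j then 1 else 0))"

definition matrix_embedding ::
    "nat \<Rightarrow> (nat \<Rightarrow> 'a::complex_banach) \<Rightarrow> (nat \<Rightarrow> 'a dual) \<Rightarrow> complex mat \<Rightarrow> 'a approximable"
  where "matrix_embedding n x xs A = (\<Sum>i<n. \<Sum>j<n. A $$ (i, j) *\<^sub>C (x i \<otimes>\<^sub>F xs j))"

definition directed_by :: "'l set \<Rightarrow> ('l \<Rightarrow> 'l \<Rightarrow> bool) \<Rightarrow> bool"
  where "directed_by \<Lambda> rel \<longleftrightarrow>
    \<Lambda> \<noteq> {} \<and> (\<forall>k\<in>\<Lambda>. rel k k) \<and>
    (\<forall>k\<in>\<Lambda>. \<forall>l\<in>\<Lambda>. \<forall>m\<in>\<Lambda>. rel k l \<longrightarrow> rel l m \<longrightarrow> rel k m) \<and>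
    (\<forall>k\<in>\<Lambda>. \<forall>l\<in>\<Lambda>. \<exists>m\<in>\<Lambda>. rel k m \<and> rel l m)"

definition net_filter :: "'l set \<Rightarrow> ('l \<Rightarrow> 'l \<Rightarrow> bool) \<Rightarrow> 'l filter"
  where "net_filter \<Lambda> rel = (INF l\<in>\<Lambda>. principal {m \<in> \<Lambda>. rel l m})"

lemma eventually_net_filter:
  assumes "directed_by \<Lambda> rel"
  shows "eventually P (net_filter \<Lambda> rel) \<longleftrightarrow> (\<exists>l\<in>\<Lambda>. \<forall>m\<in>\<Lambda>. rel l m \<longrightarrow> P m)"
  unfolding net_filter_def
proof (subst eventually_INF_base)
  show "\<Lambda> \<noteq> {}" using assms unfolding directed_by_def by blast
  show "\<exists>x\<in>\<Lambda>. principal {m \<in> \<Lambda>. rel x m} \<le>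
      inf (principal {m \<in> \<Lambda>. rel a m}) (principal {m \<in> \<Lambda>. rel b m})"
    if ab: "a \<in> \<Lambda>" "b \<in> \<Lambda>" for a b
  proof -
    obtain m where m: "m \<in> \<Lambda>" "rel a m" "rel b m"
      using assms ab unfolding directed_by_def by blast
    have trans: "rel k l \<Longrightarrow> rel l n \<Longrightarrow> rel k n" if "k \<in> \<Lambda>" "l \<in> \<Lambda>" "n \<in> \<Lambda>" for k l n
      using assms that unfolding directed_by_def by blast
    have "{k \<in> \<Lambda>. rel m k} \<subseteq> {k \<in> \<Lambda>. rel a k} \<inter> {k \<in> \<Lambda>. rel b k}"
      using ab m by (auto intro: trans[of _ m])
    then show ?thesis using m(1) by (intro bexI[of _ m]) simp_all
  qed
  show "(\<exists>b\<in>\<Lambda>. eventually P (principal {m \<in> \<Lambda>. rel b m})) \<longleftrightarrow>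
      (\<exists>l\<in>\<Lambda>. \<forall>m\<in>\<Lambda>. rel l m \<longrightarrow> P m)"
    unfolding eventually_principal by blast
qed

text \<open>As for \<^const>\<open>amenable\<close>, the type \<open>'l\<close> of which the index set of the net is a subset is a
  parameter. Here it occurs existentially: in a hypothesis \<open>property_A TYPE('a) TYPE('l)\<close> with
  free \<open>'l\<close> the net may be indexed by any directed set.\<close>

definition property_A :: "'a::complex_banach itself \<Rightarrow> 'l itself \<Rightarrow> bool"
  where "property_A _ _ \<longleftrightarrow>
    (\<exists>(\<Lambda> :: 'l set) rel n (x :: 'l \<Rightarrow> nat \<Rightarrow> 'a) (xs :: 'l \<Rightarrow> nat \<Rightarrow> 'a dual).
      directed_by \<Lambda> rel \<and>
      (\<forall>l\<in>\<Lambda>. 1 \<le> n l \<and> biorthogonal (n l) (x l) (xs l)) \<and>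
      (let E = (\<lambda>l. matrix_embedding (n l) (x l) (xs l));
           P = (\<lambda>l. operator_of (E l (1\<^sub>m (n l))))
       in (\<forall>z. ((\<lambda>l. cblinfun_apply (P l) z) \<longlongrightarrow> z) (net_filter \<Lambda> rel)) \<and>
          (\<forall>\<phi>. ((\<lambda>l. adjoint (P l) \<phi>) \<longlongrightarrow> \<phi>) (net_filter \<Lambda> rel)) \<and>
          (\<exists>G. (\<forall>l\<in>\<Lambda>. irreducible_matrix_group (n l) (G l)) \<and>
               bdd_above {norm (E l g) | l g. l \<in> \<Lambda> \<and> g \<in> G l})))"

end

theory Submission
  imports Defs
begin

text \<open>Fix a derivation \<open>D\<close> into a dual module and one biorthogonal system of the net, with embedding
  \<open>E\<close>, matrix group \<open>G\<close> and \<open>P = E 1\<close>. The averaged tensor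
  \<open>1/|G| \<cdot> \<Sum>g\<in>G. E g \<otimes> E (inverse g)\<close> has three properties. Its projective norm is bounded by the
  square of the uniform bound \<open>K\<close> on the groups. Multiplying it out gives \<open>P\<close>. It commutes with every
  \<open>E h\<close>, \<open>h \<in> G\<close>, by translating the sum, hence with the whole range of \<open>E\<close>, since an irreducible group
  spans the matrices (\<open>group_average_commutes\<close>).

  For an approximable operator \<open>T\<close> the corner \<open>P T P\<close> lies in the range of \<open>E\<close>
  (\<open>corner_in_range_E\<close>). Along the net \<open>P T \<longlongrightarrow> T\<close> and \<open>T P \<longlongrightarrow> T\<close> in norm
  (\<open>bounded_strong_approximate_unit\<close>): on rank-one operators these are the strong convergence of \<open>P\<close>
  and of its adjoint, and the rest is density, because the norms of the \<open>P\<close> are bounded by \<open>K\<close>.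
  Density needs each finite-rank operator to be a sum of rank-one operators with continuous
  functionals. This is purely algebraic once the dual separates points, and it does so here because
  the coefficient functionals of \<open>P z \<longlongrightarrow> z \<noteq> 0\<close> cannot all vanish at \<open>z\<close>. So the averaged tensors
  form a bounded approximate diagonal.

  The classical passage from an approximate diagonal to amenability first reduces to modules on which
  the algebra acts nondegenerately. That reduction is avoided by adding a correction term: with
  \<open>u g \<otimes> v g\<close> for the summands of the averaged tensor, the functionals
  \<open>\<phi> = (\<Sum>g. u g \<cdot> D (v g)) - D P \<cdot> P\<close>
  satisfy \<open>T \<cdot> \<phi> - \<phi> \<cdot> T \<longlongrightarrow> D T\<close> in norm for every \<open>T\<close> (\<open>implementer_commutator\<close> exhibits the error).
  They are bounded, so they have a weak-star cluster point (\<open>bounded_dual_net_cluster_point\<close>), and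
  this cluster point implements \<open>D\<close>.\<close>

section \<open>Complex-linear maps\<close>

lemma clinear_zero: assumes "clinear f" shows "f 0 = 0"
  using clinearD(2)[OF assms, of 0 0] by simp

lemma clinear_diff: assumes "clinear f" shows "f (x - y) = f x - f y"
  using clinearD(1)[OF assms, of "x - y" y] by simp

lemma clinear_scaleR: assumes "clinear f" shows "f (r *\<^sub>R x) = r *\<^sub>R f x"
  unfolding scaleR_scaleC by (rule clinearD(2)[OF assms])

lemma clinear_sum:
  assumes "clinear f"
  shows "f (\<Sum>i\<in>I. x i) = (\<Sum>i\<in>I. f (x i))"
  by (induction I rule: infinite_finite_induct) (simp_all add: clinear_zero[OF assms] clinearD[OF assms])

lemma cblinfun_apply_sum: "cblinfun_apply (\<Sum>i\<in>I. f i) x = (\<Sum>i\<in>I. cblinfun_apply (f i) x)"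
  by (induction I rule: infinite_finite_induct) (simp_all add: cblinfun_apply_add)

lemma norm_cblinfun_bound:
  assumes "0 \<le> b" and "\<And>x. norm (cblinfun_apply f x) \<le> b * norm x"
  shows "norm f \<le> b"
  unfolding norm_cblinfun_onorm by (rule onorm_bound) (fact assms)+

lemma clinear_continuous_imp_bounded_linear:
  fixes f :: "'a::complex_normed_vector \<Rightarrow> 'b::complex_normed_vector"
  assumes "clinear f" and "continuous_on UNIV f"
  shows "bounded_linear f"
proof -
  have "isCont f 0"
    by (rule continuous_on_interior[OF assms(2)]) simp
  moreover have "(0::real) < 1"
    by simp
  ultimately obtain d where d: "0 < d" "\<And>x. dist x 0 < d \<Longrightarrow> dist (f x) (f 0) < 1"
    unfolding continuous_at_eps_delta by meson
  have bound: "norm (f x) \<le> norm x * (2 / d)" for x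
  proof (cases "x = 0")
    case True
    show ?thesis unfolding True clinear_zero[OF assms(1)] by simp
  next
    case False
    define r where "r = d / (2 * norm x)"
    have "0 < r" 
      using False d(1) by (simp add: r_def)
    have "norm (r *\<^sub>R x) = d / 2" using False d(1) by (simp add: r_def)
    then have "dist (r *\<^sub>R x) 0 < d"
      using d(1) by simp
    from d(2)[OF this] have "r * norm (f x) < 1"
      unfolding clinear_scaleR[OF assms(1)] clinear_zero[OF assms(1)] dist_norm using \<open>0 < r\<close> by simp
    then have "norm (f x) \<le> 1 / r"
      using \<open>0 < r\<close> by (simp add: pos_le_divide_eq mult.commute)
    then show ?thesis by (simp add: r_def mult.commute)
  qed
  show ?thesis
    by (rule bounded_linear_intro)
      (fact clinearD(1)[OF assms(1)] clinear_scaleR[OF assms(1)] bound)+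
qed


section \<open>Weak-star cluster points\<close>

text \<open>Banach--Alaoglu: on a norm-bounded net the values at \<open>z\<close> stay in a disc of radius
  \<open>C * norm z\<close>, and the product of these discs is compact by Tychonoff. A cluster point in the
  product is linear because linearity consists of closed conditions on coordinates. Instead of
  passing to a subnet, the conclusion records that the cluster point takes the limit value at every
  vector where the whole net converges.\<close>

lemma bounded_dual_net_cluster_point:
  fixes f :: "'l \<Rightarrow> 'z::complex_normed_vector dual"
  assumes "F \<noteq> bot" and bound: "\<forall>\<^sub>F l in F. norm (f l) \<le> C"
  obtains \<phi> :: "'z dual"
  where "\<And>z w. ((\<lambda>l. cblinfun_apply (f l) z) \<longlongrightarrow> w) F \<Longrightarrow> cblinfun_apply \<phi> z = w"
proof -
  define S where "S = PiE UNIV (\<lambda>z::'z. cball (0::complex) (C * norm z))"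
  have "compactin (product_topology (\<lambda>_. euclidean) UNIV) S"
    unfolding S_def compactin_PiE by simp
  then have "compact S"
    by (simp add: euclidean_product_topology)
  define H where "H = filtermap (\<lambda>l. cblinfun_apply (f l)) F"
  have "H \<noteq> bot"
    using \<open>F \<noteq> bot\<close> by (simp add: H_def filtermap_bot_iff)
  moreover have "\<forall>\<^sub>F r in H. r \<in> S"
    unfolding H_def eventually_filtermap using bound
  proof eventually_elim
    case (elim l)
    have "norm (cblinfun_apply (f l) z) \<le> C * norm z" for z
      using norm_cblinfun_apply[of "f l" z] mult_right_mono[OF elim norm_ge_zero[of z]] by linarith
    then show ?case by (simp add: S_def PiE_iff)
  qed
  ultimately obtain q where "q \<in> S" and nontrivial: "inf (nhds q) H \<noteq> bot"
    using \<open>compact S\<close> unfolding compact_filter by blast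
  define N where "N = inf (nhds q) H"
  have coordinate: "((\<lambda>r. r z) \<longlongrightarrow> q z) N" for z
  proof (rule tendsto_mono)
    show "N \<le> nhds q" by (simp add: N_def)
    have "continuous_on UNIV (\<lambda>r :: 'z \<Rightarrow> complex. r z)"
      by (rule continuous_on_product_coordinates)
    then show "((\<lambda>r. r z) \<longlongrightarrow> q z) (nhds q)"
      unfolding continuous_on_def tendsto_at_iff_tendsto_nhds[of "\<lambda>r. r z" q, symmetric] by simp
  qed
  have "N \<le> H" by (simp add: N_def)
  then have ev: "(\<And>l. P (cblinfun_apply (f l))) \<Longrightarrow> eventually P N" for P
    by (rule filter_leD) (simp add: H_def eventually_filtermap)
  have unique: "a = b" if "((\<lambda>r. g r) \<longlongrightarrow> a) N" "((\<lambda>r. h r) \<longlongrightarrow> b) N" "\<forall>\<^sub>F r in N. g r = h r"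
    for a b :: complex and g h
    by (rule tendsto_unique[OF nontrivial[folded N_def] _ that(2)])
      (use that(1) tendsto_cong[OF that(3)] in simp)
  have "q (x + y) = q x + q y" for x y
    by (rule unique[OF coordinate tendsto_add[OF coordinate coordinate]])
      (rule ev, rule clinearD(1)[OF clinear_cblinfun_apply])
  moreover have "q (c *\<^sub>C x) = c *\<^sub>C q x" for c x
    by (rule unique[OF coordinate bounded_linear.tendsto[OF bounded_linear_scaleC coordinate]])
      (rule ev, rule clinearD(2)[OF clinear_cblinfun_apply])
  ultimately have lin: "clinear q"
    by (rule clinearI)
  have "norm (q z) \<le> norm z * C" for z
    using \<open>q \<in> S\<close> by (auto simp: S_def PiE_iff mult.commute)
  then have "bounded_linear q"
    by (intro bounded_linear_intro) (simp_all add: clinearD[OF lin] clinear_scaleR[OF lin])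
  show thesis
  proof (rule that[of "CBlinfun q"])
    fix z w assume "((\<lambda>l. cblinfun_apply (f l) z) \<longlongrightarrow> w) F"
    then have "((\<lambda>r. r z) \<longlongrightarrow> w) N"
      using \<open>N \<le> H\<close> by (intro tendsto_mono[of N H]) (simp_all add: H_def filterlim_filtermap)
    then show "cblinfun_apply (CBlinfun q) z = w"
      using tendsto_unique[OF _ coordinate] nontrivial
      by (simp add: N_def cblinfun_apply_CBlinfun[OF \<open>bounded_linear q\<close> lin])
  qed
qed


section \<open>Derivations into dual modules and approximate diagonals\<close>

context banach_bimodule
begin

lemma dual_action_bounds:
  obtains K where "0 \<le> K" and "\<And>a \<phi>. norm (dual_lact ract a \<phi>) \<le> norm a * norm \<phi> * K"
    and "\<And>a \<phi>. norm (dual_ract lact \<phi> a) \<le> norm \<phi> * norm a * K"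
proof -
  obtain L where L: "0 < L" "\<And>a z. norm (lact a z) \<le> norm a * norm z * L"
    using bounded_bilinear.pos_bounded[OF bounded_bilinear_lact] by blast
  obtain R where R: "0 < R" "\<And>z a. norm (ract z a) \<le> norm z * norm a * R"
    using bounded_bilinear.pos_bounded[OF bounded_bilinear_ract] by blast
  have l: "norm (dual_lact ract a \<phi>) \<le> norm a * norm \<phi> * (L + R)" for a \<phi>
  proof (rule norm_cblinfun_bound)
    fix z
    have "norm (cblinfun_apply \<phi> (ract z a)) \<le> norm \<phi> * (norm z * norm a * R)"
      using norm_cblinfun_apply[of \<phi> "ract z a"] mult_left_mono[OF R(2) norm_ge_zero[of \<phi>]]
      by (rule order_trans)
    also have "\<dots> \<le> norm a * norm \<phi> * (L + R) * norm z"
      using L(1) by (simp add: algebra_simps)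
    finally show "norm (cblinfun_apply (dual_lact ract a \<phi>) z)
        \<le> norm a * norm \<phi> * (L + R) * norm z"
      by (simp add: dual_lact_apply)
  qed (use L(1) R(1) in simp)
  have r: "norm (dual_ract lact \<phi> a) \<le> norm \<phi> * norm a * (L + R)" for a \<phi>
  proof (rule norm_cblinfun_bound)
    fix z
    have "norm (cblinfun_apply \<phi> (lact a z)) \<le> norm \<phi> * (norm a * norm z * L)"
      using norm_cblinfun_apply[of \<phi> "lact a z"] mult_left_mono[OF L(2) norm_ge_zero[of \<phi>]]
      by (rule order_trans)
    also have "\<dots> \<le> norm \<phi> * norm a * (L + R) * norm z"
      using R(1) by (simp add: algebra_simps)
    finally show "norm (cblinfun_apply (dual_ract lact \<phi> a) z)
        \<le> norm \<phi> * norm a * (L + R) * norm z"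
      by (simp add: dual_ract_apply)
  qed (use L(1) R(1) in simp)
  show thesis
    using L(1) R(1) by (intro that[OF _ l r]) simp
qed

lemma dual_lact_add_left: "dual_lact ract (a + b) \<phi> = dual_lact ract a \<phi> + dual_lact ract b \<phi>"
  by (rule cblinfun_eqI) (simp add: dual_lact_apply cblinfun_apply_add
      bounded_bilinear.add_right[OF bounded_bilinear_ract] clinearD[OF clinear_cblinfun_apply])

lemma dual_lact_add_right: "dual_lact ract a (\<phi> + \<psi>) = dual_lact ract a \<phi> + dual_lact ract a \<psi>"
  by (rule cblinfun_eqI) (simp add: dual_lact_apply cblinfun_apply_add)

lemma dual_ract_add_left: "dual_ract lact (\<phi> + \<psi>) a = dual_ract lact \<phi> a + dual_ract lact \<psi> a"
  by (rule cblinfun_eqI) (simp add: dual_ract_apply cblinfun_apply_add)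

lemma dual_ract_add_right: "dual_ract lact \<phi> (a + b) = dual_ract lact \<phi> a + dual_ract lact \<phi> b"
  by (rule cblinfun_eqI) (simp add: dual_ract_apply cblinfun_apply_add
      bounded_bilinear.add_left[OF bounded_bilinear_lact] clinearD[OF clinear_cblinfun_apply])

lemma clinear_dual_lact_left: "clinear (\<lambda>a. dual_lact ract a \<phi>)"
  by (rule clinearI, rule dual_lact_add_left, rule cblinfun_eqI)
    (simp add: dual_lact_apply cblinfun_apply_scaleC ract_scaleC_right
      clinearD[OF clinear_cblinfun_apply])

lemma clinear_dual_lact: "clinear (dual_lact ract a)"
  by (rule clinearI, rule dual_lact_add_right, rule cblinfun_eqI)
    (simp add: dual_lact_apply cblinfun_apply_scaleC)

lemma clinear_dual_ract_left: "clinear (\<lambda>\<phi>. dual_ract lact \<phi> a)"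
  by (rule clinearI, rule dual_ract_add_left, rule cblinfun_eqI)
    (simp add: dual_ract_apply cblinfun_apply_scaleC)

lemma clinear_dual_ract: "clinear (dual_ract lact \<phi>)"
  by (rule clinearI, rule dual_ract_add_right, rule cblinfun_eqI)
    (simp add: dual_ract_apply cblinfun_apply_scaleC lact_scaleC_left
      clinearD[OF clinear_cblinfun_apply])

lemma dual_lact_mult: "dual_lact ract (a * b) \<phi> = dual_lact ract a (dual_lact ract b \<phi>)"
  by (rule cblinfun_eqI) (simp add: dual_lact_apply ract_mult)

lemma dual_ract_mult: "dual_ract lact \<phi> (a * b) = dual_ract lact (dual_ract lact \<phi> a) b"
  by (rule cblinfun_eqI) (simp add: dual_ract_apply lact_mult)

lemma dual_lact_ract:
  "dual_lact ract a (dual_ract lact \<phi> b) = dual_ract lact (dual_lact ract a \<phi>) b"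
  by (rule cblinfun_eqI) (simp add: dual_lact_apply dual_ract_apply lact_ract)

end

locale continuous_dual_derivation = banach_bimodule lact ract
  for lact :: "'a::complex_banach_algebra \<Rightarrow> 'z::complex_banach \<Rightarrow> 'z" and ract +
  fixes D :: "'a \<Rightarrow> 'z dual"
  assumes derivation: "dual_derivation lact ract D"
    and continuous: "continuous_on UNIV D"
begin

abbreviation left_action (infixr \<open>\<rightharpoonup>\<close> 75) where "a \<rightharpoonup> \<phi> \<equiv> dual_lact ract a \<phi>"
abbreviation right_action (infixl \<open>\<leftharpoonup>\<close> 75) where "\<phi> \<leftharpoonup> a \<equiv> dual_ract lact \<phi> a"

lemma clinear_D: "clinear D"
  using derivation by (simp add: dual_derivation_def)

lemma product_rule: "D (a * b) = a \<rightharpoonup> D b + D a \<leftharpoonup> b"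
  using derivation by (simp add: dual_derivation_def)

lemma bounded_linear_D: "bounded_linear D"
  by (rule clinear_continuous_imp_bounded_linear[OF clinear_D continuous])

text \<open>The candidate for the implementing functional, for a diagonal \<open>\<Sum>g. u g \<otimes> v g\<close> with product
  \<open>p = (\<Sum>g. u g * v g)\<close>. If \<open>p\<close> is a unit acting as the identity on the module, then \<open>D p = 0\<close> and
  the first sum implements \<open>D\<close>. In general that sum misses \<open>D\<close> by terms in \<open>D p\<close>, which the second
  summand removes.\<close>

definition implementer :: "'g set \<Rightarrow> ('g \<Rightarrow> 'a) \<Rightarrow> ('g \<Rightarrow> 'a) \<Rightarrow> 'z dual"
  where "implementer I u v =
    (\<Sum>g\<in>I. u g \<rightharpoonup> D (v g)) - D (\<Sum>g\<in>I. u g * v g) \<leftharpoonup> (\<Sum>g\<in>I. u g * v g)"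

text \<open>The error in \<open>D a = a \<rightharpoonup> \<phi> - \<phi> \<leftharpoonup> a\<close> splits into a failure of the diagonal to commute
  with \<open>a\<close> and failures of \<open>p\<close> to be a unit for \<open>a\<close>. Three consequences of the product rule
  produce it: \<open>u \<rightharpoonup> D v \<leftharpoonup> a = u \<rightharpoonup> D (v * a) - (u * v) \<rightharpoonup> D a\<close>,
  \<open>p \<rightharpoonup> D a = D (p * a) - D p \<leftharpoonup> a\<close> and, since \<open>p\<close> is idempotent,
  \<open>a \<rightharpoonup> D p \<leftharpoonup> p = D (a * p - a) \<leftharpoonup> p\<close>.\<close>

lemma implementer_commutator:
  assumes p: "p = (\<Sum>g\<in>I. u g * v g)" and idem: "p * p = p"
  shows "a \<rightharpoonup> implementer I u v - implementer I u v \<leftharpoonup> a =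
    (\<Sum>g\<in>I. (a * u g) \<rightharpoonup> D (v g) - u g \<rightharpoonup> D (v g * a))
      + D (p * a) + D p \<leftharpoonup> (p * a - a) - D (a * p - a) \<leftharpoonup> p"
proof -
  have sum: "a \<rightharpoonup> (\<Sum>g\<in>I. u g \<rightharpoonup> D (v g)) - (\<Sum>g\<in>I. u g \<rightharpoonup> D (v g)) \<leftharpoonup> a
      = (\<Sum>g\<in>I. (a * u g) \<rightharpoonup> D (v g) - u g \<rightharpoonup> D (v g * a)) + p \<rightharpoonup> D a"
  proof -
    have "(u g \<rightharpoonup> D (v g)) \<leftharpoonup> a = u g \<rightharpoonup> D (v g * a) - (u g * v g) \<rightharpoonup> D a" for g
      by (simp add: product_rule dual_lact_add_right dual_lact_mult dual_lact_ract)
    then show ?thesis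
      by (simp add: clinear_sum[OF clinear_dual_lact] clinear_sum[OF clinear_dual_ract_left]
          clinear_sum[OF clinear_dual_lact_left] p dual_lact_mult sum_subtractf sum.distrib)
  qed
  have left: "p \<rightharpoonup> D a = D (p * a) - D p \<leftharpoonup> a"
    by (simp add: product_rule)
  have "a \<rightharpoonup> (D p \<leftharpoonup> p) = (D (a * p) - D a \<leftharpoonup> p) \<leftharpoonup> p"
    by (simp add: product_rule dual_lact_ract)
  also have "\<dots> = D (a * p - a) \<leftharpoonup> p"
    by (simp add: clinear_diff[OF clinear_dual_ract_left] clinear_diff[OF clinear_D]
        dual_ract_mult[symmetric] idem)
  finally have right: "a \<rightharpoonup> (D p \<leftharpoonup> p) = D (a * p - a) \<leftharpoonup> p" .
  show ?thesis
    unfolding implementer_def p[symmetric]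
    by (simp add: clinear_diff[OF clinear_dual_lact] clinear_diff[OF clinear_dual_ract_left]
        clinear_diff[OF clinear_dual_ract] right dual_ract_mult[symmetric])
      (use sum left in \<open>simp add: algebra_simps\<close>)
qed

text \<open>A net of elements \<open>\<Sum>g\<in>I l. u l g \<otimes> v l g\<close> of the algebraic tensor square plays the part of
  a bounded approximate diagonal. It commutes exactly with the corners \<open>p l * a * p l\<close>, and these
  approximate \<open>a\<close>, so it commutes asymptotically with \<open>a\<close>. The functionals \<open>implementer\<close> are
  bounded, and any weak-star cluster point of them implements the derivation. Tensors enter only
  through the bilinear map \<open>(x, y) \<mapsto> x \<rightharpoonup> D y\<close>, so commutation is asked for its values and no tensor
  product has to be constructed.\<close>

proposition inner_if_commuting_corner_diagonals:
  fixes F :: "'l filter" and I :: "'l \<Rightarrow> 'g set" and u v :: "'l \<Rightarrow> 'g \<Rightarrow> 'a" and p :: "'l \<Rightarrow> 'a"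
  assumes "F \<noteq> bot"
    and p: "\<And>l. p l = (\<Sum>g\<in>I l. u l g * v l g)"
    and bound: "\<forall>\<^sub>F l in F. (\<Sum>g\<in>I l. norm (u l g) * norm (v l g)) \<le> K"
    and idem: "\<forall>\<^sub>F l in F. p l * p l = p l"
    and left_unit: "\<And>a. ((\<lambda>l. p l * a) \<longlongrightarrow> a) F"
    and right_unit: "\<And>a. ((\<lambda>l. a * p l) \<longlongrightarrow> a) F"
    and commute: "\<And>a. \<forall>\<^sub>F l in F. (\<Sum>g\<in>I l. (p l * a * p l * u l g) \<rightharpoonup> D (v l g)) =
      (\<Sum>g\<in>I l. u l g \<rightharpoonup> D (v l g * (p l * a * p l)))"
  shows "inner_dual_derivation lact ract D"
proof -
  obtain M where M: "0 \<le> M" "\<And>a \<phi>. norm (a \<rightharpoonup> \<phi>) \<le> norm a * norm \<phi> * M"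
    "\<And>a \<phi>. norm (\<phi> \<leftharpoonup> a) \<le> norm \<phi> * norm a * M"
    using dual_action_bounds by metis
  obtain N where N: "0 < N" "\<And>a. norm (D a) \<le> norm a * N"
    using bounded_linear.pos_bounded[OF bounded_linear_D] by blast
  have act_D: "norm (a \<rightharpoonup> D b) \<le> norm a * norm b * (N * M)" for a b
  proof -
    have "norm (a \<rightharpoonup> D b) \<le> norm a * norm (D b) * M" by (rule M)
    also have "\<dots> \<le> norm a * (norm b * N) * M"
      by (intro mult_right_mono mult_left_mono N M) simp
    finally show ?thesis by (simp add: mult_ac)
  qed
  have D_act: "norm (D b \<leftharpoonup> a) \<le> norm b * norm a * (N * M)" for a b
  proof -
    have "norm (D b \<leftharpoonup> a) \<le> norm (D b) * norm a * M" by (rule M)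
    also have "\<dots> \<le> norm b * N * norm a * M"
      by (intro mult_right_mono N M) simp
    finally show ?thesis by (simp add: mult_ac)
  qed
  have norm_p: "\<forall>\<^sub>F l in F. norm (p l) \<le> K"
    using bound
  proof eventually_elim
    case (elim l)
    have "norm (p l) \<le> (\<Sum>g\<in>I l. norm (u l g) * norm (v l g))"
      unfolding p by (intro sum_norm_le norm_mult_ineq)
    with elim show ?case by simp
  qed
  define \<phi> where "\<phi> l = implementer (I l) (u l) (v l)" for l
  have "\<forall>\<^sub>F l in F. norm (\<phi> l) \<le> K * (N * M) + K * K * (N * M)"
    using bound norm_p
  proof eventually_elim
    case (elim l)
    have "norm (\<Sum>g\<in>I l. u l g \<rightharpoonup> D (v l g))
        \<le> (\<Sum>g\<in>I l. norm (u l g) * norm (v l g)) * (N * M)"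
      unfolding sum_distrib_right by (intro sum_norm_le act_D)
    also have "\<dots> \<le> K * (N * M)"
      using elim M(1) N(1) by (intro mult_right_mono) auto
    finally have 1: "norm (\<Sum>g\<in>I l. u l g \<rightharpoonup> D (v l g)) \<le> K * (N * M)" .
    have "norm (D (p l) \<leftharpoonup> p l) \<le> norm (p l) * norm (p l) * (N * M)"
      by (rule D_act)
    also have "\<dots> \<le> K * K * (N * M)"
      using elim M(1) N(1) order_trans[OF norm_ge_zero elim(2)]
      by (intro mult_right_mono mult_mono) auto
    finally show ?case
      unfolding \<phi>_def implementer_def p[symmetric]
      by (rule order_trans[OF norm_triangle_ineq4 add_mono[OF 1]])
  qed
  then obtain \<psi> where
    \<psi>: "\<And>z w. ((\<lambda>l. cblinfun_apply (\<phi> l) z) \<longlongrightarrow> w) F \<Longrightarrow> cblinfun_apply \<psi> z = w"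
    using bounded_dual_net_cluster_point[OF \<open>F \<noteq> bot\<close>] by metis

  have implements: "((\<lambda>l. a \<rightharpoonup> \<phi> l - \<phi> l \<leftharpoonup> a) \<longlongrightarrow> D a) F" for a
  proof -
    have left0: "((\<lambda>l. norm (p l * a - a)) \<longlongrightarrow> 0) F"
      and right0: "((\<lambda>l. norm (a * p l - a)) \<longlongrightarrow> 0) F"
      using left_unit[of a] right_unit[of a] by (simp_all add: tendsto_norm_zero_iff LIM_zero_iff)
    define e where "e l = K * norm (a * p l - a) + norm (p l * a - a)" for l
    have "(e \<longlongrightarrow> K * 0 + 0) F"
      unfolding e_def by (intro tendsto_add tendsto_mult tendsto_const left0 right0)
    then have e0: "(e \<longlongrightarrow> 0) F" by simp

    \<comment> \<open>By exact commutation the corner of \<open>a\<close> contributes zero, and \<open>a - p l * a * p l\<close> is small.\<close>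
    have "\<forall>\<^sub>F l in F. norm (\<Sum>g\<in>I l. (a * u l g) \<rightharpoonup> D (v l g) - u l g \<rightharpoonup> D (v l g * a))
        \<le> e l * (K * (2 * (N * M)))"
      using bound norm_p commute[of a]
    proof eventually_elim
      case (elim l)
      define b where "b = a - p l * a * p l"
      have "norm (p l * (a * p l - a)) \<le> K * norm (a * p l - a)"
        using norm_mult_ineq mult_right_mono[OF elim(2) norm_ge_zero] by (rule order_trans)
      moreover have "- b = p l * (a * p l - a) + (p l * a - a)"
        by (simp add: b_def algebra_simps)
      then have "norm b = norm (p l * (a * p l - a) + (p l * a - a))"
        using norm_minus_cancel[of b] by simp
      ultimately have b: "norm b \<le> e l"
        using norm_triangle_ineq[of "p l * (a * p l - a)" "p l * a - a"]
        unfolding e_def by linarith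
      have corner: "(\<Sum>g\<in>I l. (p l * a * p l * u l g) \<rightharpoonup> D (v l g)) =
          (\<Sum>g\<in>I l. u l g \<rightharpoonup> D (v l g * (p l * a * p l)))"
        by (fact elim(3))
      have "a * u l g = b * u l g + p l * a * p l * u l g"
        "v l g * a = v l g * b + v l g * (p l * a * p l)" for g
        by (simp_all add: b_def left_diff_distrib right_diff_distrib)
      then have "(a * u l g) \<rightharpoonup> D (v l g) - u l g \<rightharpoonup> D (v l g * a) =
          ((b * u l g) \<rightharpoonup> D (v l g) - u l g \<rightharpoonup> D (v l g * b)) +
          ((p l * a * p l * u l g) \<rightharpoonup> D (v l g) - u l g \<rightharpoonup> D (v l g * (p l * a * p l)))" for g
        by (simp only: dual_lact_add_left dual_lact_add_right clinearD(1)[OF clinear_D]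
            add_diff_add)
      then have "(\<Sum>g\<in>I l. (a * u l g) \<rightharpoonup> D (v l g) - u l g \<rightharpoonup> D (v l g * a)) =
          (\<Sum>g\<in>I l. (b * u l g) \<rightharpoonup> D (v l g) - u l g \<rightharpoonup> D (v l g * b))"
        using corner by (simp add: sum.distrib sum_subtractf)
      also have "norm \<dots> \<le> (\<Sum>g\<in>I l. norm (u l g) * norm (v l g) * (2 * norm b * (N * M)))"
      proof (rule sum_norm_le)
        fix g
        have "norm ((b * u l g) \<rightharpoonup> D (v l g)) \<le> norm b * norm (u l g) * norm (v l g) * (N * M)"
          using M(1) N(1)
          by (intro order_trans[OF act_D] mult_right_mono norm_mult_ineq) auto
        moreover have "norm (u l g \<rightharpoonup> D (v l g * b))
            \<le> norm (u l g) * (norm (v l g) * norm b) * (N * M)"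
          using M(1) N(1)
          by (intro order_trans[OF act_D] mult_right_mono mult_left_mono norm_mult_ineq) auto
        ultimately show "norm ((b * u l g) \<rightharpoonup> D (v l g) - u l g \<rightharpoonup> D (v l g * b))
            \<le> norm (u l g) * norm (v l g) * (2 * norm b * (N * M))"
          by (intro order_trans[OF norm_triangle_ineq4]) (simp add: algebra_simps)
      qed
      also have "\<dots> = (\<Sum>g\<in>I l. norm (u l g) * norm (v l g)) * (2 * norm b * (N * M))"
        by (simp add: sum_distrib_right)
      also have "\<dots> \<le> K * (2 * e l * (N * M))"
        using elim b M(1) N(1) order_trans[OF norm_ge_zero elim(2)]
        by (intro mult_mono mult_left_mono mult_right_mono) auto
      finally show ?case by (simp add: mult_ac)
    qed
    then have 1: "((\<lambda>l. \<Sum>g\<in>I l. (a * u l g) \<rightharpoonup> D (v l g) - u l g \<rightharpoonup> D (v l g * a)) \<longlongrightarrow> 0) F"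
      by (rule Lim_null_comparison) (rule tendsto_mult_left_zero[OF e0])
    have 2: "((\<lambda>l. D (p l * a)) \<longlongrightarrow> D a) F"
      by (rule bounded_linear.tendsto[OF bounded_linear_D left_unit])
    have "\<forall>\<^sub>F l in F. norm (D (p l) \<leftharpoonup> (p l * a - a)) \<le> norm (p l * a - a) * (K * (N * M))"
      using norm_p
    proof eventually_elim
      case (elim l)
      have "norm (p l) * norm (p l * a - a) * (N * M) \<le> K * norm (p l * a - a) * (N * M)"
        using elim M(1) N(1) by (intro mult_right_mono) auto
      then show ?case
        using D_act[of "p l" "p l * a - a"] by (simp add: mult_ac)
    qed
    then have 3: "((\<lambda>l. D (p l) \<leftharpoonup> (p l * a - a)) \<longlongrightarrow> 0) F"
      by (rule Lim_null_comparison) (rule tendsto_mult_left_zero[OF left0])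
    have "\<forall>\<^sub>F l in F. norm (D (a * p l - a) \<leftharpoonup> p l) \<le> norm (a * p l - a) * (K * (N * M))"
      using norm_p
    proof eventually_elim
      case (elim l)
      have "norm (a * p l - a) * norm (p l) * (N * M) \<le> norm (a * p l - a) * K * (N * M)"
        using elim M(1) N(1) by (intro mult_right_mono mult_left_mono) auto
      then show ?case
        using D_act[of "a * p l - a" "p l"] by (simp add: mult_ac)
    qed
    then have 4: "((\<lambda>l. D (a * p l - a) \<leftharpoonup> p l) \<longlongrightarrow> 0) F"
      by (rule Lim_null_comparison) (rule tendsto_mult_left_zero[OF right0])
    have "\<forall>\<^sub>F l in F. (\<Sum>g\<in>I l. (a * u l g) \<rightharpoonup> D (v l g) - u l g \<rightharpoonup> D (v l g * a))
        + D (p l * a) + D (p l) \<leftharpoonup> (p l * a - a) - D (a * p l - a) \<leftharpoonup> p l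
        = a \<rightharpoonup> \<phi> l - \<phi> l \<leftharpoonup> a"
      using idem by eventually_elim (simp add: \<phi>_def implementer_commutator[OF p])
    then show ?thesis
      using tendsto_diff[OF tendsto_add[OF tendsto_add[OF 1 2] 3] 4]
      by (simp add: tendsto_cong)
  qed

  show "inner_dual_derivation lact ract D"
    unfolding inner_dual_derivation_def
  proof (intro exI allI cblinfun_eqI)
    fix a z
    have "bounded_linear (\<lambda>f :: 'z dual. cblinfun_apply f z)"
      using norm_cblinfun_apply[of _ z]
      by (intro bounded_linear_intro[where K = "norm z"])
        (simp_all add: cblinfun_apply_add scaleR_scaleC cblinfun_apply_scaleC)
    then have "((\<lambda>l. cblinfun_apply (a \<rightharpoonup> \<phi> l - \<phi> l \<leftharpoonup> a) z) \<longlongrightarrow> cblinfun_apply (D a) z) F"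
      by (rule bounded_linear.tendsto[OF _ implements])
    then have "cblinfun_apply \<psi> (ract z a - lact a z) = cblinfun_apply (D a) z"
      by (intro \<psi>) (simp add: cblinfun_apply_diff dual_lact_apply dual_ract_apply
          clinear_diff[OF clinear_cblinfun_apply])
    then show "cblinfun_apply (D a) z = cblinfun_apply (a \<rightharpoonup> \<psi> - \<psi> \<leftharpoonup> a) z"
      by (simp add: cblinfun_apply_diff dual_lact_apply dual_ract_apply
          clinear_diff[OF clinear_cblinfun_apply])
  qed
qed

end

section \<open>Matrix units and averaging over a matrix group\<close>

lemma tensor_mult: "(x \<otimes>\<^sub>F f) * (y \<otimes>\<^sub>F g) = cblinfun_apply f y *\<^sub>C (x \<otimes>\<^sub>F g)"
  by transfer (rule cblinfun_eqI, simp add: cblinfun_apply_rank_one cblinfun_apply_scaleC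
      scaleC_complex_def scaleC_scaleC mult.commute clinearD(2)[OF clinear_cblinfun_apply])

lemma tensor_mult_left: "T * (x \<otimes>\<^sub>F f) = cblinfun_apply (operator_of T) x \<otimes>\<^sub>F f"
  by transfer (rule cblinfun_eqI, simp add: cblinfun_apply_rank_one
      clinearD(2)[OF clinear_cblinfun_apply])

lemma tensor_mult_right: "(x \<otimes>\<^sub>F f) * T = x \<otimes>\<^sub>F adjoint (operator_of T) f"
  by transfer (rule cblinfun_eqI, simp add: cblinfun_apply_rank_one adjoint_def)

locale biorthogonal_system =
  fixes n :: nat and x :: "nat \<Rightarrow> 'a::complex_banach" and xs :: "nat \<Rightarrow> 'a dual"
  assumes biorthogonal: "biorthogonal n x xs"
begin

abbreviation E :: "complex mat \<Rightarrow> 'a approximable"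
  where "E \<equiv> matrix_embedding n x xs"

lemma E_tensor:
  assumes "k < n"
  shows "E A * (x k \<otimes>\<^sub>F g) = (\<Sum>i<n. A $$ (i, k) *\<^sub>C (x i \<otimes>\<^sub>F g))"
proof -
  have "E A * (x k \<otimes>\<^sub>F g)
      = (\<Sum>i<n. \<Sum>j<n. A $$ (i, j) *\<^sub>C cblinfun_apply (xs j) (x k) *\<^sub>C (x i \<otimes>\<^sub>F g))"
    by (simp add: matrix_embedding_def sum_distrib_right mult_scaleC_left tensor_mult)
  also have "\<dots> = (\<Sum>i<n. \<Sum>j<n. if k = j then A $$ (i, j) *\<^sub>C (x i \<otimes>\<^sub>F g) else 0)"
    using biorthogonal assms
    by (intro sum.cong refl) (auto simp: biorthogonal_def scaleC_one)
  also have "\<dots> = (\<Sum>i<n. A $$ (i, k) *\<^sub>C (x i \<otimes>\<^sub>F g))"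
    using assms by simp
  finally show ?thesis .
qed

lemma E_mult:
  assumes "A \<in> carrier_mat n n" and "B \<in> carrier_mat n n"
  shows "E (A * B) = E A * E B"
proof -
  have "E A * E B = (\<Sum>k<n. \<Sum>l<n. \<Sum>i<n. (A $$ (i, k) * B $$ (k, l)) *\<^sub>C (x i \<otimes>\<^sub>F xs l))"
    by (subst (2) matrix_embedding_def)
      (simp add: sum_distrib_left mult_scaleC_right E_tensor complex_vector.scale_sum_right scaleC_scaleC
        mult.commute)
  also have "\<dots> = (\<Sum>k<n. \<Sum>i<n. \<Sum>l<n. (A $$ (i, k) * B $$ (k, l)) *\<^sub>C (x i \<otimes>\<^sub>F xs l))"
    by (rule sum.cong[OF refl], rule sum.swap)
  also have "\<dots> = (\<Sum>i<n. \<Sum>k<n. \<Sum>l<n. (A $$ (i, k) * B $$ (k, l)) *\<^sub>C (x i \<otimes>\<^sub>F xs l))"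
    by (rule sum.swap)
  also have "\<dots> = (\<Sum>i<n. \<Sum>l<n. \<Sum>k<n. (A $$ (i, k) * B $$ (k, l)) *\<^sub>C (x i \<otimes>\<^sub>F xs l))"
    by (rule sum.cong[OF refl], rule sum.swap)
  also have "\<dots> = E (A * B)"
    unfolding matrix_embedding_def
  proof (intro sum.cong refl)
    fix i l assume "i \<in> {..<n}" "l \<in> {..<n}"
    then have "(A * B) $$ (i, l) = (\<Sum>k<n. A $$ (i, k) * B $$ (k, l))"
      using assms by (simp add: scalar_prod_def lessThan_atLeast0)
    then show "(\<Sum>k<n. (A $$ (i, k) * B $$ (k, l)) *\<^sub>C (x i \<otimes>\<^sub>F xs l)) =
        (A * B) $$ (i, l) *\<^sub>C (x i \<otimes>\<^sub>F xs l)"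
      by (simp add: complex_vector.scale_sum_left)
  qed
  finally show ?thesis ..
qed

lemma E_linear_combination:
  "E (mat n n (\<lambda>(i, j). \<Sum>g\<in>G. c g * g $$ (i, j))) = (\<Sum>g\<in>G. c g *\<^sub>C E g)"
proof -
  have "E (mat n n (\<lambda>(i, j). \<Sum>g\<in>G. c g * g $$ (i, j)))
      = (\<Sum>i<n. \<Sum>j<n. \<Sum>g\<in>G. c g *\<^sub>C g $$ (i, j) *\<^sub>C (x i \<otimes>\<^sub>F xs j))"
    by (simp add: matrix_embedding_def complex_vector.scale_sum_left scaleC_scaleC)
  also have "\<dots> = (\<Sum>i<n. \<Sum>g\<in>G. \<Sum>j<n. c g *\<^sub>C g $$ (i, j) *\<^sub>C (x i \<otimes>\<^sub>F xs j))"
    by (rule sum.cong[OF refl], rule sum.swap)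
  also have "\<dots> = (\<Sum>g\<in>G. \<Sum>i<n. \<Sum>j<n. c g *\<^sub>C g $$ (i, j) *\<^sub>C (x i \<otimes>\<^sub>F xs j))"
    by (rule sum.swap)
  also have "\<dots> = (\<Sum>g\<in>G. c g *\<^sub>C E g)"
    by (simp add: matrix_embedding_def complex_vector.scale_sum_right)
  finally show ?thesis .
qed

lemma E_one: "E (1\<^sub>m n) = (\<Sum>i<n. x i \<otimes>\<^sub>F xs i)"
proof -
  have "E (1\<^sub>m n) = (\<Sum>i<n. \<Sum>j<n. if i = j then x i \<otimes>\<^sub>F xs j else 0)"
    unfolding matrix_embedding_def by (intro sum.cong refl) (simp add: scaleC_one)
  then show ?thesis by simp
qed

text \<open>Compressing any operator by \<open>P = E 1\<close> lands in the range of \<open>E\<close>: the entries of the matrix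
  are the values \<open>xs i (T (x j))\<close>.\<close>

lemma corner_in_range_E:
  obtains A where "A \<in> carrier_mat n n" and "E (1\<^sub>m n) * T * E (1\<^sub>m n) = E A"
proof
  define A where "A = mat n n (\<lambda>(i, j). cblinfun_apply (xs i) (cblinfun_apply (operator_of T) (x j)))"
  show "A \<in> carrier_mat n n" by (simp add: A_def)
  have "E (1\<^sub>m n) * T * E (1\<^sub>m n) = (\<Sum>j<n. \<Sum>i<n. (x i \<otimes>\<^sub>F xs i) * (T * (x j \<otimes>\<^sub>F xs j)))"
    by (simp add: E_one sum_distrib_right sum_distrib_left mult.assoc)
  also have "\<dots> = (\<Sum>i<n. \<Sum>j<n. (x i \<otimes>\<^sub>F xs i) * (T * (x j \<otimes>\<^sub>F xs j)))"
    by (rule sum.swap)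
  also have "\<dots> = E A"
    unfolding tensor_mult_left[of T] tensor_mult by (simp add: matrix_embedding_def A_def)
  finally show "E (1\<^sub>m n) * T * E (1\<^sub>m n) = E A" .
qed

end

lemma (in group) sum_translate:
  assumes "h \<in> carrier G"
  shows "(\<Sum>g\<in>carrier G. f (h \<otimes> g) (inv g)) = (\<Sum>g\<in>carrier G. f g (inv g \<otimes> h))"
  using assms
  by (intro sum.reindex_bij_witness[where i = "\<lambda>g. inv h \<otimes> g" and j = "\<lambda>g. h \<otimes> g"])
    (simp_all add: m_assoc[symmetric] inv_mult_group, simp add: m_assoc)

lemma group_GL: "group (GL n)"
proof -
  interpret ring "ring_mat TYPE(complex) n ()" by (rule ring_mat)
  show ?thesis unfolding GL_def by (rule units_group)
qed

text \<open>The elements \<open>\<Sum>g\<in>G. E g \<otimes> E (inverse g)\<close> commute with \<open>E h\<close> for \<open>h \<in> G\<close> by translation,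
  and hence with the whole range of \<open>E\<close>, because an irreducible group spans the matrices.\<close>

lemma (in biorthogonal_system) group_average_commutes:
  fixes B :: "'a approximable \<Rightarrow> 'a approximable \<Rightarrow> 'b::complex_vector"
  assumes G: "irreducible_matrix_group n G" and A: "A \<in> carrier_mat n n"
    and B: "\<And>y. clinear (B y)" "\<And>z. clinear (\<lambda>y. B y z)"
  shows "(\<Sum>g\<in>G. B (E A * E g) (E (inv\<^bsub>GL n\<^esub> g))) =
    (\<Sum>g\<in>G. B (E g) (E (inv\<^bsub>GL n\<^esub> g) * E A))"
proof -
  interpret GL: group "GL n" by (rule group_GL)
  have sub: "subgroup G (GL n)"
    using G by (simp add: irreducible_matrix_group_def)
  have carrier: "g \<in> carrier_mat n n" and inv_carrier: "inv\<^bsub>GL n\<^esub> g \<in> carrier_mat n n"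
    if "g \<in> G" for g
  proof -
    have "carrier (GL n) \<subseteq> carrier_mat n n"
      by (auto simp: GL_def units_of_carrier Units_def ring_mat_simps)
    then show "g \<in> carrier_mat n n" "inv\<^bsub>GL n\<^esub> g \<in> carrier_mat n n"
      using subgroup.mem_carrier[OF sub] subgroup.m_inv_closed[OF sub that] that by blast+
  qed
  have translate: "(\<Sum>g\<in>G. B (E h * E g) (E (inv\<^bsub>GL n\<^esub> g))) =
      (\<Sum>g\<in>G. B (E g) (E (inv\<^bsub>GL n\<^esub> g) * E h))" if h: "h \<in> G" for h
  proof -
    interpret H: group "GL n\<lparr>carrier := G\<rparr>"
      by (rule GL.subgroup_imp_group[OF sub])
    have inv: "inv\<^bsub>GL n\<lparr>carrier := G\<rparr>\<^esub> g = inv\<^bsub>GL n\<^esub> g" if "g \<in> G" for g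
      by (rule GL.m_inv_consistent[OF sub that])
    have mult: "g \<otimes>\<^bsub>GL n\<^esub> k = g * k" for g k
      by (simp add: GL_def units_of_mult ring_mat_simps)
    show ?thesis
      using H.sum_translate[of h "\<lambda>y z. B (E y) (E z)"] h
      by (simp add: inv mult E_mult carrier inv_carrier)
  qed
  obtain c where c: "A = mat n n (\<lambda>(i, j). \<Sum>h\<in>G. c h * h $$ (i, j))"
    using G A unfolding irreducible_matrix_group_def by blast
  have EA: "E A = (\<Sum>h\<in>G. c h *\<^sub>C E h)"
    unfolding c by (rule E_linear_combination)
  have "(\<Sum>g\<in>G. B (E A * E g) (E (inv\<^bsub>GL n\<^esub> g)))
      = (\<Sum>g\<in>G. \<Sum>h\<in>G. c h *\<^sub>C B (E h * E g) (E (inv\<^bsub>GL n\<^esub> g)))"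
    by (simp add: EA sum_distrib_right mult_scaleC_left clinear_sum[OF B(2)] clinearD(2)[OF B(2)])
  also have "\<dots> = (\<Sum>h\<in>G. c h *\<^sub>C (\<Sum>g\<in>G. B (E h * E g) (E (inv\<^bsub>GL n\<^esub> g))))"
    unfolding complex_vector.scale_sum_right by (rule sum.swap)
  also have "\<dots> = (\<Sum>h\<in>G. c h *\<^sub>C (\<Sum>g\<in>G. B (E g) (E (inv\<^bsub>GL n\<^esub> g) * E h)))"
    by (simp add: translate)
  also have "\<dots> = (\<Sum>g\<in>G. \<Sum>h\<in>G. c h *\<^sub>C B (E g) (E (inv\<^bsub>GL n\<^esub> g) * E h))"
    unfolding complex_vector.scale_sum_right by (rule sum.swap)
  also have "\<dots> = (\<Sum>g\<in>G. B (E g) (E (inv\<^bsub>GL n\<^esub> g) * E A))"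
    by (simp add: EA sum_distrib_left mult_scaleC_right clinear_sum[OF B(1)] clinearD(2)[OF B(1)])
  finally show ?thesis .
qed

section \<open>Approximate units for the approximable operators\<close>

text \<open>One rank-one summand is split off at a time. Let \<open>C\<close> and one more vector span the range of
  \<open>T\<close>, let \<open>y = T z\<close> lie outside the span of \<open>C\<close>, and let \<open>\<phi> y = 1\<close>. By exchange \<open>C\<close> and \<open>y\<close> span the
  range too, and \<open>T - rank_one y (adjoint T \<phi>)\<close> is \<open>T\<close> followed by the projection \<open>Q\<close> along \<open>y\<close>, so
  its range is spanned by the image of \<open>C\<close> alone. The hypothesis that the dual separates points
  stands in for the Hahn--Banach theorem.\<close>

lemma finite_rank_in_span_rank_one:
  fixes T :: "('a::complex_normed_vector, 'b::complex_normed_vector) cblinfun"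
  assumes separating: "\<And>y::'b. y \<noteq> 0 \<Longrightarrow> \<exists>\<phi> :: 'b dual. cblinfun_apply \<phi> y \<noteq> 0"
    and "finite_rank T"
  shows "T \<in> complex_vector.span {rank_one x \<phi> | x \<phi>. True}"
proof -
  let ?R = "complex_vector.span {rank_one x \<phi> | (x :: 'b) (\<phi> :: 'a dual). True}"
  have "T \<in> ?R" if "finite B" "card B \<le> n" "range (cblinfun_apply T) \<subseteq> complex_vector.span B"
    for n B and T :: "('a, 'b) cblinfun"
    using that
  proof (induction n arbitrary: B T)
    case 0
    then have "cblinfun_apply T x = 0" for x by auto
    then have "T = 0" by (intro cblinfun_eqI) simp
    then show ?case by (simp add: complex_vector.span_zero)
  next
    case (Suc n)
    show ?case
    proof (cases "\<exists>b C. B = insert b C \<and> card C \<le> n \<and> finite C")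
      case False
      then have "B = {}"
        using Suc.prems(1,2)
        by (metis card_insert_disjoint ex_in_conv finite_insert mk_disjoint_insert not_less_eq_eq)
      then show ?thesis using Suc.IH[of B T] Suc.prems by simp
    next
      case True
      then obtain b C where C: "B = insert b C" "card C \<le> n" "finite C" by blast
      show ?thesis
      proof (cases "range (cblinfun_apply T) \<subseteq> complex_vector.span C")
        case True
        then show ?thesis using Suc.IH C by blast
      next
        case False
        then obtain z where z: "cblinfun_apply T z \<notin> complex_vector.span C" by blast
        define y where "y = cblinfun_apply T z"
        have "y \<noteq> 0" using z complex_vector.span_zero[of C] unfolding y_def by metis
        then obtain \<psi> :: "'b dual" where \<psi>: "cblinfun_apply \<psi> y \<noteq> 0" using separating by blast
        define \<phi> where "\<phi> = inverse (cblinfun_apply \<psi> y) *\<^sub>C \<psi>"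
        have \<phi>: "cblinfun_apply \<phi> y = 1"
          using \<psi> by (simp add: \<phi>_def cblinfun_apply_scaleC scaleC_complex_def)
        define Q where "Q w = w - cblinfun_apply \<phi> w *\<^sub>C y" for w
        have "clinear Q"
          by (rule clinearI) (simp_all add: Q_def clinearD[OF clinear_cblinfun_apply]
              scaleC_add_left complex_vector.scale_right_diff_distrib scaleC_complex_def scaleC_scaleC)
        then interpret Q: Vector_Spaces.linear scaleC scaleC Q .
        have "y \<in> complex_vector.span (insert b C)"
          using Suc.prems(3) C(1) by (auto simp: y_def)
        then have b: "b \<in> complex_vector.span (insert y C)"
          using z complex_vector.in_span_insert by (auto simp: y_def)
        have "range (cblinfun_apply T) \<subseteq> complex_vector.span (insert y C)"
        proof -
          have "insert b C \<subseteq> complex_vector.span (insert y C)"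
            using b complex_vector.span_superset[of "insert y C"] by blast
          then have "complex_vector.span (insert b C) \<subseteq> complex_vector.span (insert y C)"
            by (rule complex_vector.span_minimal) (rule complex_vector.subspace_span)
          then show ?thesis using Suc.prems(3) C(1) by blast
        qed
        then have "Q ` range (cblinfun_apply T) \<subseteq> complex_vector.span (Q ` insert y C)"
          unfolding Q.span_image by blast
        moreover have "Q y = 0" by (simp add: Q_def \<phi> scaleC_one)
        ultimately have rangeQ: "Q ` range (cblinfun_apply T) \<subseteq> complex_vector.span (Q ` C)"
          by (simp add: complex_vector.span_insert_0)
        define S where "S = T - rank_one y (adjoint T \<phi>)"
        have "cblinfun_apply S w = Q (cblinfun_apply T w)" for w
          by (simp add: S_def Q_def cblinfun_apply_diff cblinfun_apply_rank_one adjoint_def)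
        then have "range (cblinfun_apply S) \<subseteq> complex_vector.span (Q ` C)"
          using rangeQ by auto
        moreover have "card (Q ` C) \<le> n"
          using card_image_le[OF C(3), of Q] C(2) by linarith
        ultimately have "S \<in> ?R"
          using Suc.IH[of "Q ` C" S] C(3) by blast
        moreover have "rank_one y (adjoint T \<phi>) \<in> ?R"
          by (rule complex_vector.span_base) blast
        ultimately have "S + rank_one y (adjoint T \<phi>) \<in> ?R"
          by (rule complex_vector.span_add)
        then show ?thesis by (simp add: S_def)
      qed
    qed
  qed
  then show ?thesis
    using assms(2) unfolding finite_rank_def by blast
qed

lemma norm_tensor_le: "norm (x \<otimes>\<^sub>F f) \<le> norm x * norm f"
  unfolding norm_approximable.rep_eq tensor.rep_eq
proof (rule norm_cblinfun_bound)
  fix z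
  show "norm (cblinfun_apply (rank_one x f) z) \<le> norm x * norm f * norm z"
    using mult_left_mono[OF norm_cblinfun_apply[of f z] norm_ge_zero[of x]]
    by (simp add: cblinfun_apply_rank_one norm_scaleC mult_ac)
qed simp

lemma tensor_diff_left: "(x - y) \<otimes>\<^sub>F f = x \<otimes>\<^sub>F f - y \<otimes>\<^sub>F f"
  by transfer (rule cblinfun_eqI, simp add: cblinfun_apply_rank_one cblinfun_apply_diff
      complex_vector.scale_right_diff_distrib)

lemma tensor_diff_right: "x \<otimes>\<^sub>F (f - g) = x \<otimes>\<^sub>F f - x \<otimes>\<^sub>F g"
  by transfer (rule cblinfun_eqI, simp add: cblinfun_apply_rank_one cblinfun_apply_diff
      complex_vector.scale_left_diff_distrib)

lemma tendsto_tensor_left: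
  assumes "(y \<longlongrightarrow> x) F"
  shows "((\<lambda>l. y l \<otimes>\<^sub>F f) \<longlongrightarrow> x \<otimes>\<^sub>F f) F"
proof (rule LIM_zero_cancel, rule Lim_null_comparison)
  show "\<forall>\<^sub>F l in F. norm (y l \<otimes>\<^sub>F f - x \<otimes>\<^sub>F f) \<le> norm (y l - x) * norm f"
    unfolding tensor_diff_left[symmetric] by (intro always_eventually allI norm_tensor_le)
  show "((\<lambda>l. norm (y l - x) * norm f) \<longlongrightarrow> 0) F"
    using assms by (intro tendsto_mult_left_zero tendsto_norm_zero LIM_zero)
qed

lemma tendsto_tensor_right:
  assumes "(g \<longlongrightarrow> f) F"
  shows "((\<lambda>l. x \<otimes>\<^sub>F g l) \<longlongrightarrow> x \<otimes>\<^sub>F f) F"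
proof (rule LIM_zero_cancel, rule Lim_null_comparison)
  show "\<forall>\<^sub>F l in F. norm (x \<otimes>\<^sub>F g l - x \<otimes>\<^sub>F f) \<le> norm x * norm (g l - f)"
    unfolding tensor_diff_right[symmetric] by (intro always_eventually allI norm_tensor_le)
  show "((\<lambda>l. norm x * norm (g l - f)) \<longlongrightarrow> 0) F"
    using assms by (intro tendsto_mult_right_zero tendsto_norm_zero LIM_zero)
qed

text \<open>The usual three-epsilon argument for an equicontinuous net.\<close>

lemma closed_convergence_to_identity:
  fixes L :: "'l \<Rightarrow> 'a::real_normed_vector \<Rightarrow> 'a"
  assumes diff: "\<And>l a b. L l (a - b) = L l a - L l b"
    and bound: "\<forall>\<^sub>F l in F. \<forall>a. norm (L l a) \<le> K * norm a"
  shows "closed {a. ((\<lambda>l. L l a) \<longlongrightarrow> a) F}"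
proof -
  have "((\<lambda>l. L l a) \<longlongrightarrow> a) F" if lim: "s \<longlonglongrightarrow> a" and s: "\<And>k. ((\<lambda>l. L l (s k)) \<longlongrightarrow> s k) F" for s a
  proof (rule tendstoI)
    fix e :: real assume "0 < e"
    define d where "d = e / (2 * (\<bar>K\<bar> + 1))"
    have "0 < \<bar>K\<bar> + 1" by simp
    then have "0 < d" and "d * (2 * (\<bar>K\<bar> + 1)) = e"
      using \<open>0 < e\<close> unfolding d_def by (simp_all del: distrib_left distrib_right)
    then have d: "0 < d" "\<bar>K\<bar> * d + d = e / 2"
      by (simp_all add: algebra_simps)
    from lim d(1) obtain k where k: "norm (s k - a) < d"
      by (metis LIMSEQ_D order_refl)
    have "\<forall>\<^sub>F l in F. dist (L l (s k)) (s k) < e / 2"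
      by (rule tendstoD[OF s]) (use \<open>0 < e\<close> in simp)
    with bound show "\<forall>\<^sub>F l in F. dist (L l a) a < e"
    proof eventually_elim
      case (elim l)
      have "norm (L l (a - s k)) \<le> \<bar>K\<bar> * d"
      proof -
        have "norm (L l (a - s k)) \<le> K * norm (a - s k)" using elim(1) by blast
        also have "\<dots> \<le> \<bar>K\<bar> * d"
          using k by (intro mult_mono) (auto simp: norm_minus_commute)
        finally show ?thesis .
      qed
      moreover have "L l a - a = L l (a - s k) + (L l (s k) - s k) + (s k - a)"
        by (simp add: diff)
      then have "norm (L l a - a) \<le> norm (L l (a - s k)) + norm (L l (s k) - s k) + norm (s k - a)"
        by (metis (no_types) norm_triangle_ineq norm_triangle_mono order_refl)
      ultimately show ?case
        using elim(2) k d(2) by (simp add: dist_norm)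
    qed
  qed
  then show ?thesis
    unfolding closed_sequential_limits by blast
qed

text \<open>Strong convergence of the operators handles the left factor of a tensor, strong convergence
  of their adjoints the right factor; the tensors span a dense subspace.\<close>

lemma bounded_strong_approximate_unit:
  fixes p :: "'l \<Rightarrow> 'a::complex_banach approximable"
  assumes separating: "\<And>y::'a. y \<noteq> 0 \<Longrightarrow> \<exists>\<phi> :: 'a dual. cblinfun_apply \<phi> y \<noteq> 0"
    and bound: "\<forall>\<^sub>F l in F. norm (p l) \<le> K"
    and strong: "\<And>z. ((\<lambda>l. cblinfun_apply (operator_of (p l)) z) \<longlongrightarrow> z) F"
    and strong_adjoint: "\<And>\<phi>. ((\<lambda>l. adjoint (operator_of (p l)) \<phi>) \<longlongrightarrow> \<phi>) F"
  shows "((\<lambda>l. p l * T) \<longlongrightarrow> T) F" and "((\<lambda>l. T * p l) \<longlongrightarrow> T) F"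
proof -
  define S where "S = {T. ((\<lambda>l. p l * T) \<longlongrightarrow> T) F} \<inter> {T. ((\<lambda>l. T * p l) \<longlongrightarrow> T) F}"
  have "closed S"
    unfolding S_def
  proof (intro closed_Int closed_convergence_to_identity[where K = K])
    show "\<forall>\<^sub>F l in F. \<forall>T. norm (p l * T) \<le> K * norm T"
      using bound by eventually_elim
        (meson norm_mult_ineq mult_right_mono norm_ge_zero order_trans)
    show "\<forall>\<^sub>F l in F. \<forall>T. norm (T * p l) \<le> K * norm T"
      using bound
    proof eventually_elim
      case (elim l)
      show ?case
      proof
        fix T
        have "norm (T * p l) \<le> norm T * norm (p l)" by (rule norm_mult_ineq)
        also have "\<dots> \<le> K * norm T"
          using mult_left_mono[OF elim norm_ge_zero[of T]] by (simp add: mult.commute)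
        finally show "norm (T * p l) \<le> K * norm T" .
      qed
    qed
  qed (simp_all add: left_diff_distrib right_diff_distrib)
  have finite_rank_in_S: "R \<in> operator_of ` S" if "finite_rank R" for R :: "('a, 'a) cblinfun"
  proof -
    have "R \<in> complex_vector.span {rank_one x \<phi> | x \<phi>. True}"
      by (rule finite_rank_in_span_rank_one) (fact separating that)+
    then show ?thesis
    proof (induction R rule: complex_vector.span_induct_alt)
      case base
      have "0 \<in> S" by (simp add: S_def)
      then show ?case by (rule rev_image_eqI) (rule zero_approximable.rep_eq[symmetric])
    next
      case (step c R\<^sub>1 R\<^sub>2)
      then obtain x \<phi> T where R: "R\<^sub>1 = rank_one x \<phi>" "R\<^sub>2 = operator_of T" and "T \<in> S" by blast
      have "x \<otimes>\<^sub>F \<phi> \<in> S"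
        unfolding S_def Int_iff mem_Collect_eq tensor_mult_left tensor_mult_right
        by (intro conjI tendsto_tensor_left tendsto_tensor_right strong strong_adjoint)
      then have "c *\<^sub>C (x \<otimes>\<^sub>F \<phi>) + T \<in> S"
        using \<open>T \<in> S\<close> unfolding S_def mem_Collect_eq Int_iff distrib_left distrib_right
          mult_scaleC_left mult_scaleC_right
        by (intro conjI tendsto_add bounded_linear.tendsto[OF bounded_linear_scaleC]) simp_all
      moreover have "operator_of (c *\<^sub>C (x \<otimes>\<^sub>F \<phi>) + T) = c *\<^sub>C R\<^sub>1 + R\<^sub>2"
        by (simp add: R plus_approximable.rep_eq scaleC_approximable.rep_eq tensor.rep_eq)
      ultimately show ?case by (rule rev_image_eqI[OF _ sym])
    qed
  qed
  \<comment> \<open>The closure of the finite-rank operators is taken among all bounded operators, so an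
    approximating sequence has to be lifted before \<open>closed S\<close> applies.\<close>
  have "T \<in> S"
  proof -
    obtain R where R: "\<And>k. finite_rank (R k)" "R \<longlonglongrightarrow> operator_of T"
      using operator_of[of T] unfolding closure_sequential by blast
    have "\<forall>k. \<exists>t. t \<in> S \<and> R k = operator_of t"
      using finite_rank_in_S[OF R(1)] by blast
    from choice[OF this] obtain s where s: "\<And>k. s k \<in> S" "\<And>k. R k = operator_of (s k)"
      by blast
    have "dist f g = dist (operator_of f) (operator_of g)" for f g :: "'a approximable"
      unfolding dist_norm by transfer simp
    then have "s \<longlonglongrightarrow> T"
      using R(2) unfolding tendsto_iff s(2) by simp
    then show ?thesis
      by (rule closed_sequentially[OF \<open>closed S\<close> s(1)])
  qed
  then show "((\<lambda>l. p l * T) \<longlongrightarrow> T) F" "((\<lambda>l. T * p l) \<longlongrightarrow> T) F"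
    by (simp_all add: S_def)
qed

text \<open>The source of separating functionals: if \<open>E 1 z\<close> converges to some \<open>z \<noteq> 0\<close> along a net of
  systems, then it is eventually nonzero.\<close>

lemma (in biorthogonal_system) E_apply_nonzero:
  assumes "cblinfun_apply (operator_of (E A)) z \<noteq> 0"
  shows "\<exists>j. cblinfun_apply (xs j) z \<noteq> 0"
proof (rule ccontr)
  assume "\<not> ?thesis"
  then have zero: "cblinfun_apply (xs j) z = 0" for j by blast
  have sum: "operator_of (\<Sum>i\<in>I. T i) = (\<Sum>i\<in>I. operator_of (T i))"
    for I :: "nat set" and T :: "nat \<Rightarrow> 'a approximable"
    by (induction I rule: infinite_finite_induct)
      (simp_all add: zero_approximable.rep_eq plus_approximable.rep_eq)
  have "cblinfun_apply (operator_of (E A)) z = 0"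
    by (simp add: matrix_embedding_def sum scaleC_approximable.rep_eq tensor.rep_eq
        cblinfun_apply_sum cblinfun_apply_scaleC cblinfun_apply_rank_one zero)
  with assms show False ..
qed

section \<open>Amenability\<close>

theorem theorem4p2:
  assumes "infinite_dimensional TYPE('x::complex_banach)"
    and "property_A TYPE('x) TYPE('l)"
  shows "amenable TYPE('x approximable) TYPE('z::complex_banach)"
proof -
  obtain \<Lambda> :: "'l set" and rel n and x :: "'l \<Rightarrow> nat \<Rightarrow> 'x" and xs G where
    directed: "directed_by \<Lambda> rel" and
    bio: "\<And>l. l \<in> \<Lambda> \<Longrightarrow> biorthogonal (n l) (x l) (xs l)" and
    strong: "\<And>z. ((\<lambda>l. cblinfun_apply (operator_of
      (matrix_embedding (n l) (x l) (xs l) (1\<^sub>m (n l)))) z) \<longlongrightarrow> z) (net_filter \<Lambda> rel)" and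
    strong_adjoint: "\<And>\<phi>. ((\<lambda>l. adjoint (operator_of
      (matrix_embedding (n l) (x l) (xs l) (1\<^sub>m (n l)))) \<phi>) \<longlongrightarrow> \<phi>) (net_filter \<Lambda> rel)" and
    irreducible: "\<And>l. l \<in> \<Lambda> \<Longrightarrow> irreducible_matrix_group (n l) (G l)" and
    bdd: "bdd_above {norm (matrix_embedding (n l) (x l) (xs l) g) | l g. l \<in> \<Lambda> \<and> g \<in> G l}"
    using assms(2) unfolding property_A_def Let_def by (elim exE conjE) (rule that, blast+)
  define F where "F = net_filter \<Lambda> rel"
  define E where "E l = matrix_embedding (n l) (x l) (xs l)" for l
  have "\<Lambda> \<noteq> {}" and rel_refl: "\<And>l. l \<in> \<Lambda> \<Longrightarrow> rel l l"
    using directed by (auto simp: directed_by_def)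
  have "F \<noteq> bot"
    unfolding F_def trivial_limit_def eventually_net_filter[OF directed] using rel_refl by blast
  have "\<forall>\<^sub>F l in F. l \<in> \<Lambda>"
    unfolding F_def eventually_net_filter[OF directed] using \<open>\<Lambda> \<noteq> {}\<close> by blast
  obtain K where K: "\<And>l g. l \<in> \<Lambda> \<Longrightarrow> g \<in> G l \<Longrightarrow> norm (E l g) \<le> K"
    using bdd unfolding bdd_above_def E_def by blast

  \<comment> \<open>The diagonal is the average over the group; only its first factor carries the weight.\<close>
  define u where "u l g = (1 / card (G l)) *\<^sub>R E l g" for l g
  define v where "v l g = E l (inv\<^bsub>GL (n l)\<^esub> g)" for l g
  define p where "p l = (\<Sum>g\<in>G l. u l g * v l g)" for l

  have at_index: "p l = E l (1\<^sub>m (n l))" "(\<Sum>g\<in>G l. norm (u l g) * norm (v l g)) \<le> K * K"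
    "norm (p l) \<le> K" "p l * p l = p l"
    "\<And>a (B :: 'x approximable \<Rightarrow> 'x approximable \<Rightarrow> 'z dual).
      (\<And>y. clinear (B y)) \<Longrightarrow> (\<And>z. clinear (\<lambda>y. B y z)) \<Longrightarrow>
      (\<Sum>g\<in>G l. B (p l * a * p l * u l g) (v l g)) =
      (\<Sum>g\<in>G l. B (u l g) (v l g * (p l * a * p l)))" if l: "l \<in> \<Lambda>" for l
  proof -
    interpret biorthogonal_system "n l" "x l" "xs l"
      by (rule biorthogonal_system.intro[OF bio[OF l]])
    interpret GL: group "GL (n l)" by (rule group_GL)
    have sub: "subgroup (G l) (GL (n l))" and fin: "finite (G l)"
      using irreducible[OF l] by (auto simp: irreducible_matrix_group_def)
    have one: "\<one>\<^bsub>GL (n l)\<^esub> = 1\<^sub>m (n l)"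
      and mult: "\<And>g h. g \<otimes>\<^bsub>GL (n l)\<^esub> h = g * h"
      and carrier: "carrier (GL (n l)) \<subseteq> carrier_mat (n l) (n l)"
      by (auto simp: GL_def units_of_carrier units_of_one units_of_mult Units_def ring_mat_simps)
    have one_G: "1\<^sub>m (n l) \<in> G l"
      using subgroup.one_closed[OF sub] by (simp add: one)
    then have card: "0 < card (G l)" using fin by (auto simp: card_gt_0_iff)
    have in_GL: "g \<in> carrier (GL (n l))" if "g \<in> G l" for g
      by (rule subgroup.mem_carrier[OF sub that])
    have inv_G: "inv\<^bsub>GL (n l)\<^esub> g \<in> G l" if "g \<in> G l" for g
      by (rule subgroup.m_inv_closed[OF sub that])
    have E_inv: "E l g * v l g = E l (1\<^sub>m (n l))" if g: "g \<in> G l" for g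
    proof -
      have "g * inv\<^bsub>GL (n l)\<^esub> g = 1\<^sub>m (n l)"
        using GL.r_inv[OF in_GL[OF g]] by (simp add: mult one)
      moreover have "g \<in> carrier_mat (n l) (n l)" "inv\<^bsub>GL (n l)\<^esub> g \<in> carrier_mat (n l) (n l)"
        using g inv_G in_GL carrier by blast+
      ultimately show ?thesis
        using E_mult[of g "inv\<^bsub>GL (n l)\<^esub> g"] by (simp add: E_def v_def)
    qed
    have "p l = (\<Sum>g\<in>G l. (1 / card (G l)) *\<^sub>R E l (1\<^sub>m (n l)))"
      unfolding p_def u_def mult_scaleR_left by (rule sum.cong[OF refl], simp only: E_inv)
    then show p: "p l = E l (1\<^sub>m (n l))"
      using card by (simp add: sum_constant_scaleR)
    then show "norm (p l) \<le> K"
      using K[OF l one_G] by simp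
    show "p l * p l = p l"
      using E_mult[of "1\<^sub>m (n l)" "1\<^sub>m (n l)"] by (simp add: p E_def)
    have "0 \<le> K"
      using K[OF l one_G] norm_ge_zero order_trans by blast
    have "(\<Sum>g\<in>G l. norm (u l g) * norm (v l g)) \<le> (\<Sum>g\<in>G l. 1 / card (G l) * (K * K))"
    proof (rule sum_mono)
      fix g assume g: "g \<in> G l"
      have "norm (u l g) * norm (v l g) = 1 / card (G l) * (norm (E l g) * norm (v l g))"
        by (simp add: u_def)
      also have "\<dots> \<le> 1 / card (G l) * (K * K)"
        using K[OF l g] K[OF l inv_G[OF g]] \<open>0 \<le> K\<close>
        by (intro mult_left_mono mult_mono) (auto simp: v_def)
      finally show "norm (u l g) * norm (v l g) \<le> 1 / card (G l) * (K * K)" .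
    qed
    then show "(\<Sum>g\<in>G l. norm (u l g) * norm (v l g)) \<le> K * K"
      using card by simp
    fix a and B :: "'x approximable \<Rightarrow> 'x approximable \<Rightarrow> 'z dual"
    assume B: "\<And>y. clinear (B y)" "\<And>z. clinear (\<lambda>y. B y z)"
    obtain A where A: "A \<in> carrier_mat (n l) (n l)" "p l * a * p l = E l A"
      using corner_in_range_E[of a] unfolding p E_def by metis
    have "(\<Sum>g\<in>G l. B (E l A * E l g) (v l g)) = (\<Sum>g\<in>G l. B (E l g) (v l g * E l A))"
      unfolding E_def v_def by (rule group_average_commutes[OF irreducible[OF l] A(1) B])
    then show "(\<Sum>g\<in>G l. B (p l * a * p l * u l g) (v l g)) =
        (\<Sum>g\<in>G l. B (u l g) (v l g * (p l * a * p l)))"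
      unfolding A(2) u_def
      by (simp only: mult_scaleR_right clinear_scaleR[OF B(2)] scaleR_sum_right[symmetric])
  qed

  have ev_p: "\<forall>\<^sub>F l in F. norm (p l) \<le> K"
    and ev_bound: "\<forall>\<^sub>F l in F. (\<Sum>g\<in>G l. norm (u l g) * norm (v l g)) \<le> K * K"
    and ev_idem: "\<forall>\<^sub>F l in F. p l * p l = p l"
    and ev_one: "\<forall>\<^sub>F l in F. E l (1\<^sub>m (n l)) = p l"
    by (rule eventually_mono[OF \<open>\<forall>\<^sub>F l in F. l \<in> \<Lambda>\<close>], fact at_index at_index(1)[symmetric])+
  have strong_p: "((\<lambda>l. cblinfun_apply (operator_of (p l)) z) \<longlongrightarrow> z) F" for z
    by (rule Lim_transform_eventually[OF strong[folded F_def E_def]])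
      (rule eventually_mono[OF ev_one], simp)
  have adjoint_p: "((\<lambda>l. adjoint (operator_of (p l)) \<phi>) \<longlongrightarrow> \<phi>) F" for \<phi>
    by (rule Lim_transform_eventually[OF strong_adjoint[folded F_def E_def]])
      (rule eventually_mono[OF ev_one], simp)
  have separating: "\<exists>\<phi> :: 'x dual. cblinfun_apply \<phi> y \<noteq> 0" if "y \<noteq> 0" for y
  proof -
    have "\<forall>\<^sub>F l in F. cblinfun_apply (operator_of (E l (1\<^sub>m (n l)))) y \<noteq> 0"
      using tendsto_imp_eventually_ne[OF strong[folded F_def E_def] that] .
    with \<open>\<forall>\<^sub>F l in F. l \<in> \<Lambda>\<close> have "\<forall>\<^sub>F l in F. \<exists>\<phi> :: 'x dual. cblinfun_apply \<phi> y \<noteq> 0"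
    proof eventually_elim
      case (elim l)
      interpret biorthogonal_system "n l" "x l" "xs l"
        by (rule biorthogonal_system.intro[OF bio[OF elim(1)]])
      show ?case using E_apply_nonzero elim(2) unfolding E_def by blast
    qed
    with \<open>F \<noteq> bot\<close> show ?thesis by simp
  qed

  have left_unit: "((\<lambda>l. p l * a) \<longlongrightarrow> a) F" for a
    by (rule bounded_strong_approximate_unit(1))
      (fact separating ev_p strong_p adjoint_p)+
  have right_unit: "((\<lambda>l. a * p l) \<longlongrightarrow> a) F" for a
    by (rule bounded_strong_approximate_unit(2))
      (fact separating ev_p strong_p adjoint_p)+

  show ?thesis
    unfolding amenable_def
  proof (intro allI impI)
    fix lact :: "'x approximable \<Rightarrow> 'z \<Rightarrow> 'z" and ract D
    assume "banach_bimodule lact ract" "dual_derivation lact ract D" "continuous_on UNIV D"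
    then interpret continuous_dual_derivation lact ract D
      by (intro continuous_dual_derivation.intro continuous_dual_derivation_axioms.intro)
    show "inner_dual_derivation lact ract D"
    proof (rule inner_if_commuting_corner_diagonals[where F = F and I = G and u = u and v = v
          and p = p])
      have "clinear (\<lambda>b. dual_lact ract a (D b))" for a
        by (rule clinearI) (simp_all add: clinearD[OF clinear_D] clinearD[OF clinear_dual_lact])
      then show "\<forall>\<^sub>F l in F.
          (\<Sum>g\<in>G l. dual_lact ract (p l * a * p l * u l g) (D (v l g))) =
          (\<Sum>g\<in>G l. dual_lact ract (u l g) (D (v l g * (p l * a * p l))))" for a
        by (intro eventually_mono[OF \<open>\<forall>\<^sub>F l in F. l \<in> \<Lambda>\<close>]
            at_index(5)[where B = "\<lambda>a b. dual_lact ract a (D b)"] clinear_dual_lact_left)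
    qed (fact \<open>F \<noteq> bot\<close> p_def ev_bound ev_idem left_unit right_unit)+
  qed
qed

end
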